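(* Let $V=\mathbb Z^d$, and let $\{\eta(t),t\ge0\}$ on $\Omega=E^V$ be dual to a discrete particle system $\{\xi(t),t\ge0\}$ on finite configurations $\xi\in\hat\Omega$ (with $\hat E\subset\mathbb N$), with factorized duality function $D(\xi,\eta)=\prod_{x\in V}d(\xi_x,\eta_x)$ satisfying $d(0,\cdot)\equiv1$. Assume that the dual process conserves the number of particles and satisfies bounded harmonic triviality, and let $p(t;x,y)$ denote the probability that the dual process started from a single particle at $x$ has its particle at $y$ at time $t$; assume $$\lim_{t\to\infty}p(t;x,y)=0\qquad\text{for all }x,y\in V.$$ Let $\mu$ be a probability measure on $\Omega$ such that the uniform domination property of $D$ w.r.t. $\mu$ holds. If $\mu$ is an ergodic stationary measure for the process $\{\eta(t),t\ge0\}$, then for all finite configurations $\xi\in\hat\Omega$ and all $x\in V$, $$\int D(\xi,\eta)\,\mu(d\eta)=\left(\int D(\delta_x,\eta)\,\mu(d\eta)\right)^{|\xi|};$$ as a consequence, $\mu$ is a product measure.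
   Context: $E$ is one of $\mathbb N=\{0,1,\dots\}$, $\{0,\dots,N\}$, or $\mathbb R_+=[0,\infty)$; $\hat E$ is $\mathbb N$ or $\{0,\dots,N\}$; $\hat\Omega=\hat E^V$. A configuration $\xi\in\hat E^V$ is finite if $|\xi|:=\sum_{x\in V}\xi_x<\infty$; for such $\xi$ the product defining $D(\xi,\eta)$ has only finitely many factors different from $1$. $\delta_x$ is the configuration with a single particle at $x$ and none elsewhere. Duality with (measurable) duality function $D$ means: for all $t>0$, all finite $\xi\in\hat\Omega$ and all $\eta\in\Omega$, $\hat{\mathbb E}_\xi D(\xi(t),\eta)=\mathbb E_\eta D(\xi,\eta(t))$. Bounded harmonic triviality of the dual process: if $H$ is a bounded function on finite configurations with $\hat{\mathbb E}_\xi H(\xi(t))=H(\xi)$ for all $t>0$ and all finite $\xi$, then $H(\xi)=\psi(|\xi|)$ for some bounded function $\psi:\mathbb N\to\mathbb R$. Uniform domination property of $D$ w.r.t. $\mu$: for all $n\in\mathbb N$ there exists a $\mu$-integrable function $f_n$ such that $\sup_{\xi\in\hat\Omega,\,|\xi|=n}|D(\xi,\eta)|\le f_n(\eta)$ for all $\eta\in\Omega$. "Ergodic stationary measure for the process" refers to ergodicity with respect to time (the stationary process started from $\mu$ is ergodic under time shifts); no translation invariance is assumed. A product measure is a measure of the form $\otimes_{x\in V}\nu_x$ with $\nu_x$ probability measures on $E$.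
   Formalization: The final clause "μ is a product measure" is proved under the added assumption that μ is the only probability measure with its integrals of D(ξ,·), ξ finite; without it the clause fails (e.g. d≡1, μ an equal mixture of all-0 and all-1). *)

theory Defs
  imports "HOL-Probability.Probability" "HOL-Library.Groups_Big_Fun"
begin

section \<open>Configurations\<close>

definition config_space :: "real set \<Rightarrow> ('v \<Rightarrow> real) measure" where
  "config_space E = Pi\<^sub>M UNIV (\<lambda>_. restrict_space borel E)"

text \<open>For \<open>nat\<close>-valued \<open>\<xi>\<close>, finiteness of the total mass is finiteness of the support.\<close>

definition finite_configs :: "nat set \<Rightarrow> ('v \<Rightarrow> nat) set" where
  "finite_configs E' = {\<xi>. (\<forall>x. \<xi> x \<in> E') \<and> finite {x. \<xi> x \<noteq> 0}}"

definition mass :: "('v \<Rightarrow> nat) \<Rightarrow> nat" where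
  "mass \<xi> = (\<Sum>x | \<xi> x \<noteq> 0. \<xi> x)"

definition delta_config :: "'v \<Rightarrow> 'v \<Rightarrow> nat" where
  "delta_config x = (\<lambda>y. if y = x then 1 else 0)"

text \<open>\<open>Prod_any\<close> multiplies over all sites; for finite \<open>\<xi>\<close> and \<open>d 0 \<eta> = 1\<close> on the local state
  space, only finitely many factors differ from 1.\<close>

definition factorized :: "(nat \<Rightarrow> real \<Rightarrow> real) \<Rightarrow> ('v \<Rightarrow> nat) \<Rightarrow> ('v \<Rightarrow> real) \<Rightarrow> real" where
  "factorized d \<xi> \<eta> = Prod_any (\<lambda>x. d (\<xi> x) (\<eta> x))"

section \<open>Markov processes, given by their path laws\<close>

definition path_space :: "'s measure \<Rightarrow> (real \<Rightarrow> 's) measure" where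
  "path_space S = Pi\<^sub>M {0..} (\<lambda>_. S)"

definition time_shift :: "real \<Rightarrow> (real \<Rightarrow> 's) \<Rightarrow> real \<Rightarrow> 's" where
  "time_shift s \<omega> = (\<lambda>t\<in>{0..}. \<omega> (s + t))"

text \<open>\<open>P x\<close> is the law on path space of the process started from \<open>x\<close>; the state at time \<open>t\<close> is
  the coordinate \<open>\<omega> t\<close>. The last clause is the Markov property at time \<open>s\<close>, for events \<open>A\<close> of the
  path up to time \<open>s\<close> and events \<open>B\<close> of the path after time \<open>s\<close>.\<close>

definition markov_process :: "'s measure \<Rightarrow> ('s \<Rightarrow> (real \<Rightarrow> 's) measure) \<Rightarrow> bool" where
  "markov_process S P \<longleftrightarrow>
     P \<in> S \<rightarrow>\<^sub>M prob_algebra (path_space S) \<and>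
     (\<forall>x\<in>space S. AE \<omega> in P x. \<omega> 0 = x) \<and>
     (\<forall>x\<in>space S. \<forall>s\<ge>0. \<forall>A\<in>sets (Pi\<^sub>M {0..s} (\<lambda>_. S)). \<forall>B\<in>sets (path_space S).
        measure (P x) {\<omega> \<in> space (path_space S). restrict \<omega> {0..s} \<in> A \<and> time_shift s \<omega> \<in> B}
        = (\<integral>\<omega>. indicator A (restrict \<omega> {0..s}) * measure (P (\<omega> s)) B \<partial>P x))"

definition stationary :: "'s measure \<Rightarrow> ('s \<Rightarrow> (real \<Rightarrow> 's) measure) \<Rightarrow> 's measure \<Rightarrow> bool" where
  "stationary S P \<mu> \<longleftrightarrow>
     prob_space \<mu> \<and> sets \<mu> = sets S \<and> (\<forall>t\<ge>0. distr (\<mu> \<bind> P) S (\<lambda>\<omega>. \<omega> t) = \<mu>)"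

text \<open>Events are required to be shift invariant only up to null sets, separately for every \<open>t\<close>.
  Strict invariance would be the wrong notion here: an event of \<open>path_space S\<close> depends on
  countably many times only, so the strictly invariant ones are trivial for every process.\<close>

definition time_ergodic :: "'s measure \<Rightarrow> ('s \<Rightarrow> (real \<Rightarrow> 's) measure) \<Rightarrow> 's measure \<Rightarrow> bool" where
  "time_ergodic S P \<mu> \<longleftrightarrow>
     (\<forall>A\<in>sets (path_space S).
        (\<forall>t\<ge>0. AE \<omega> in \<mu> \<bind> P. time_shift t \<omega> \<in> A \<longleftrightarrow> \<omega> \<in> A) \<longrightarrow>
        measure (\<mu> \<bind> P) A = 0 \<or> measure (\<mu> \<bind> P) A = 1)"

section \<open>The dual particle system\<close>

text \<open>In this section \<open>F\<close> is the set of finite configurations and \<open>Q \<xi>\<close> the path law of the dual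
  process started from \<open>\<xi>\<close>.\<close>

definition conserves_particles ::
  "('v \<Rightarrow> nat) set \<Rightarrow> (('v \<Rightarrow> nat) \<Rightarrow> (real \<Rightarrow> 'v \<Rightarrow> nat) measure) \<Rightarrow> bool" where
  "conserves_particles F Q \<longleftrightarrow> (\<forall>\<xi>\<in>F. \<forall>t\<ge>0. AE \<omega> in Q \<xi>. mass (\<omega> t) = mass \<xi>)"

definition bounded_harmonic_triviality ::
  "('v \<Rightarrow> nat) set \<Rightarrow> (('v \<Rightarrow> nat) \<Rightarrow> (real \<Rightarrow> 'v \<Rightarrow> nat) measure) \<Rightarrow> bool" where
  "bounded_harmonic_triviality F Q \<longleftrightarrow>
     (\<forall>H :: ('v \<Rightarrow> nat) \<Rightarrow> real.
        bounded (H ` F) \<and> (\<forall>t>0. \<forall>\<xi>\<in>F. (\<integral>\<omega>. H (\<omega> t) \<partial>Q \<xi>) = H \<xi>) \<longrightarrow>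
        (\<exists>\<psi> :: nat \<Rightarrow> real. bounded (range \<psi>) \<and> (\<forall>\<xi>\<in>F. H \<xi> = \<psi> (mass \<xi>))))"

definition one_particle_prob ::
  "(('v \<Rightarrow> nat) \<Rightarrow> (real \<Rightarrow> 'v \<Rightarrow> nat) measure) \<Rightarrow> real \<Rightarrow> 'v \<Rightarrow> 'v \<Rightarrow> real" where
  "one_particle_prob Q t x y =
     measure (Q (delta_config x)) {\<omega> \<in> space (Q (delta_config x)). \<omega> t = delta_config y}"

section \<open>Duality\<close>

text \<open>The integrability clauses say that both expectations exist (the Bochner integral of a
  non-integrable function is 0).\<close>

definition dual_processes ::
  "'s measure \<Rightarrow> ('s \<Rightarrow> (real \<Rightarrow> 's) measure) \<Rightarrow>
   ('v \<Rightarrow> nat) set \<Rightarrow> (('v \<Rightarrow> nat) \<Rightarrow> (real \<Rightarrow> 'v \<Rightarrow> nat) measure) \<Rightarrow>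
   (('v \<Rightarrow> nat) \<Rightarrow> 's \<Rightarrow> real) \<Rightarrow> bool" where
  "dual_processes S P F Q D \<longleftrightarrow>
     (\<forall>\<xi>\<in>F. D \<xi> \<in> borel_measurable S) \<and>
     (\<forall>t>0. \<forall>\<xi>\<in>F. \<forall>\<eta>\<in>space S.
        integrable (Q \<xi>) (\<lambda>\<omega>. D (\<omega> t) \<eta>) \<and> integrable (P \<eta>) (\<lambda>\<omega>. D \<xi> (\<omega> t)) \<and>
        (\<integral>\<omega>. D (\<omega> t) \<eta> \<partial>Q \<xi>) = (\<integral>\<omega>. D \<xi> (\<omega> t) \<partial>P \<eta>))"

definition uniformly_dominated ::
  "('v \<Rightarrow> nat) set \<Rightarrow> (('v \<Rightarrow> nat) \<Rightarrow> 's \<Rightarrow> real) \<Rightarrow> 's measure \<Rightarrow> bool" where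
  "uniformly_dominated F D \<mu> \<longleftrightarrow>
     (\<forall>n. \<exists>f. integrable \<mu> f \<and>
        (\<forall>\<eta>\<in>space \<mu>. \<forall>\<xi>\<in>F. mass \<xi> = n \<longrightarrow> \<bar>D \<xi> \<eta>\<bar> \<le> f \<eta>))"

text \<open>\<open>\<mu>\<close> is determined, among all probability measures, by its integrals against the duality
  functions. If the family is measure determining, this holds for every \<open>\<mu>\<close>.\<close>

definition determined_by ::
  "('v \<Rightarrow> nat) set \<Rightarrow> (('v \<Rightarrow> nat) \<Rightarrow> 's \<Rightarrow> real) \<Rightarrow> 's measure \<Rightarrow> bool" where
  "determined_by F D \<mu> \<longleftrightarrow>
     (\<forall>\<nu>. prob_space \<nu> \<and> sets \<nu> = sets \<mu> \<and>
        (\<forall>\<xi>\<in>F. integrable \<nu> (D \<xi>) \<and> (\<integral>\<eta>. D \<xi> \<eta> \<partial>\<nu>) = (\<integral>\<eta>. D \<xi> \<eta> \<partial>\<mu>)) \<longrightarrow> \<nu> = \<mu>)"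

definition product_measure :: "real set \<Rightarrow> ('v \<Rightarrow> real) measure \<Rightarrow> bool" where
  "product_measure E \<mu> \<longleftrightarrow>
     (\<exists>\<nu> :: 'v \<Rightarrow> real measure.
        (\<forall>x. prob_space (\<nu> x) \<and> sets (\<nu> x) = sets (restrict_space borel E)) \<and>
        \<mu> = Pi\<^sub>M UNIV \<nu>)"

end

theory Submission
  imports Defs
begin

text \<open>Write \<open>m \<xi>\<close> for the integral of \<open>D \<xi>\<close> against \<open>\<mu>\<close>. By duality and stationarity \<open>m\<close> is harmonic
  for the dual process, so \<open>m \<xi>\<close> depends on the number of particles of \<open>\<xi>\<close> only. It remains to
  see that adding a particle at an empty site \<open>z\<close> multiplies \<open>m \<xi>\<close> by the one-particle value. By
  duality, the correlation of \<open>D \<xi>\<close> at time \<open>0\<close> with \<open>D (\<delta> z)\<close> at time \<open>t\<close> is the average of the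
  integral of \<open>D \<xi> * D (\<delta> y)\<close> over the position \<open>y\<close> at time \<open>t\<close> of a dual particle started from
  \<open>z\<close>. For large \<open>t\<close> this particle is off the support of \<open>\<xi>\<close>, where the product is the duality
  function of a configuration with one particle more. Averages of the correlation over \<open>t\<close>, on the
  other hand, approach the product of the two integrals, by ergodicity. Once the moments factorize,
  \<open>\<mu>\<close> and the product of its marginals have the same moments.\<close>

section \<open>Integration\<close>

text \<open>Ergodicity controls averages over time only, so the correlation of
  \<open>D \<xi>\<close> at time 0 with \<open>D (delta_config z)\<close> at time \<open>t\<close>
  need not converge for a general process. Duality supplies the missing regularity: for every large
  \<open>t\<close> the truncated correlation is within a small error of one and the same number, the
  moment with an added particle, and so is every average of such correlations. Averaging then
  identifies this number, and no mixing is required.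

  Two limits are nested. The cutoff of \<open>D \<xi>\<close> at level \<open>k\<close> keeps the
  contribution of occupied sites finite, with a bound that grows with \<open>k\<close>; hence time
  goes to infinity at fixed \<open>k\<close>, and \<open>k\<close> afterwards.

  Particles are only ever added at empty sites. Configurations with several particles at one site
  come back through harmonic triviality: since the moment sees only the number of particles and
  there are infinitely many sites, the particles can be spread out, one per site.\<close>

text \<open>Fubini for a kernel. Tonelli gives the nonnegative case, and positive and negative parts
  give the rest. Integrability under the mixture yields integrability under \<open>N x\<close> for
  almost every \<open>x\<close> only; elsewhere the inner integral may take its default value 0,
  which a null set hides.\<close>

lemma integral_bind_integrable:
  fixes f :: "'b \<Rightarrow> real"
  assumes N: "N \<in> M \<rightarrow>\<^sub>M prob_algebra K"
    and M: "space M \<noteq> {}"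
    and f: "integrable (M \<bind> N) f"
  shows "(\<integral>y. f y \<partial>(M \<bind> N)) = (\<integral>x. (\<integral>y. f y \<partial>N x) \<partial>M)"
proof -
  have N': "N \<in> M \<rightarrow>\<^sub>M subprob_algebra K"
    by (rule measurable_prob_algebraD[OF N])
  have sets_bind_K: "sets (M \<bind> N) = sets K"
    using sets_bind_measurable[OF N' M] .
  have *: "integrable M (\<lambda>x. \<integral>y. g y \<partial>N x) \<and> (AE x in M. integrable (N x) g) \<and>
      (\<integral>y. g y \<partial>(M \<bind> N)) = (\<integral>x. (\<integral>y. g y \<partial>N x) \<partial>M)"
    if g: "integrable (M \<bind> N) g" and g0: "\<And>y. 0 \<le> g y" for g :: "'b \<Rightarrow> real"
  proof -
    have gK[measurable]: "g \<in> borel_measurable K"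
      using borel_measurable_integrable[OF g] measurable_cong_sets[OF sets_bind_K refl] by blast
    have Nx: "sets (N x) = sets K" if "x \<in> space M" for x
      using measurable_space[OF N that] by (simp add: space_prob_algebra)
    have meas: "(\<lambda>x. \<integral>y. g y \<partial>N x) \<in> borel_measurable M"
      using integral_measurable_subprob_algebra[OF gK] N' by measurable
    have fin: "(\<integral>\<^sup>+x. (\<integral>\<^sup>+y. g y \<partial>N x) \<partial>M) = ennreal (\<integral>y. g y \<partial>(M \<bind> N))"
      using nn_integral_eq_integral[OF g] g0 nn_integral_bind[OF _ N', of "\<lambda>y. ennreal (g y)"] by simp
    have "AE x in M. (\<integral>\<^sup>+y. g y \<partial>N x) \<noteq> \<infinity>"
    proof (rule nn_integral_PInf_AE)
      have "(\<lambda>m. \<integral>\<^sup>+y. ennreal (g y) \<partial>m) \<in> borel_measurable (subprob_algebra K)"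
        by (rule nn_integral_measurable_subprob_algebra) measurable
      then show "(\<lambda>x. \<integral>\<^sup>+y. ennreal (g y) \<partial>N x) \<in> borel_measurable M"
        using measurable_compose[OF N'] by blast
    qed (simp add: fin)
    then have AEi: "AE x in M. integrable (N x) g"
    proof (rule AE_mp, intro AE_I2 impI)
      fix x assume x: "x \<in> space M" and "(\<integral>\<^sup>+y. g y \<partial>N x) \<noteq> \<infinity>"
      then show "integrable (N x) g"
        using gK Nx[OF x] g0
        by (intro integrableI_nonneg) (auto simp: top.not_eq_extremum cong: measurable_cong_sets)
    qed
    have eq: "(\<integral>\<^sup>+x. ennreal (\<integral>y. g y \<partial>N x) \<partial>M) = ennreal (\<integral>y. g y \<partial>(M \<bind> N))"
      unfolding fin[symmetric]
      by (rule nn_integral_cong_AE)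
         (use AEi in \<open>eventually_elim, simp add: nn_integral_eq_integral g0\<close>)
    have "integrable M (\<lambda>x. \<integral>y. g y \<partial>N x)"
      by (rule integrableI_nonneg) (use meas in \<open>auto simp: eq g0\<close>)
    moreover have "(\<integral>x. (\<integral>y. g y \<partial>N x) \<partial>M) = (\<integral>y. g y \<partial>(M \<bind> N))"
      by (rule integral_eq_nn_integral[THEN trans]) (use meas eq g0 in auto)
    ultimately show ?thesis using AEi by simp
  qed
  have p: "integrable (M \<bind> N) (\<lambda>y. max 0 (f y))" "integrable (M \<bind> N) (\<lambda>y. max 0 (- f y))"
    using f by auto
  have PR: "integrable M (\<lambda>x. \<integral>y. max 0 (f y) \<partial>N x)" "AE x in M. integrable (N x) (\<lambda>y. max 0 (f y))"
      "(\<integral>y. max 0 (f y) \<partial>(M \<bind> N)) = (\<integral>x. (\<integral>y. max 0 (f y) \<partial>N x) \<partial>M)"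
      "integrable M (\<lambda>x. \<integral>y. max 0 (- f y) \<partial>N x)" "AE x in M. integrable (N x) (\<lambda>y. max 0 (- f y))"
      "(\<integral>y. max 0 (- f y) \<partial>(M \<bind> N)) = (\<integral>x. (\<integral>y. max 0 (- f y) \<partial>N x) \<partial>M)"
    using *[OF p(1)] *[OF p(2)] by simp_all
  have split: "f y = max 0 (f y) - max 0 (- f y)" for y by simp
  have "(\<integral>y. f y \<partial>(M \<bind> N)) = (\<integral>y. max 0 (f y) \<partial>(M \<bind> N)) - (\<integral>y. max 0 (- f y) \<partial>(M \<bind> N))"
    using p by (subst split) (rule Bochner_Integration.integral_diff)
  also have "\<dots> = (\<integral>x. (\<integral>y. max 0 (f y) \<partial>N x) - (\<integral>y. max 0 (- f y) \<partial>N x) \<partial>M)"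
    using PR by simp
  also have "\<dots> = (\<integral>x. (\<integral>y. f y \<partial>N x) \<partial>M)"
  proof (rule integral_cong_AE)
    have "f \<in> borel_measurable K"
      using borel_measurable_integrable[OF f] measurable_cong_sets[OF sets_bind_K refl] by blast
    then show "(\<lambda>x. \<integral>y. f y \<partial>N x) \<in> borel_measurable M"
      using integral_measurable_subprob_algebra N' by measurable
    show "AE x in M. (\<integral>y. max 0 (f y) \<partial>N x) - (\<integral>y. max 0 (- f y) \<partial>N x) = (\<integral>y. f y \<partial>N x)"
      using PR(2,5)
    proof eventually_elim
      case (elim x)
      show ?case
        using Bochner_Integration.integral_diff[OF elim] by (simp add: split[symmetric])
    qed
  qed (use PR in auto)
  finally show ?thesis .
qed

text \<open>Two level sets at the mean \<open>a\<close> suffice: if \<open>a < u\<close> or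
  \<open>u < a\<close> had probability 1, the mean would lie strictly above or below
  \<open>a\<close>, so both have probability 0.\<close>

lemma (in prob_space) AE_eq_expectation_of_level_sets_trivial:
  fixes u :: "'a \<Rightarrow> real"
  assumes u: "integrable M u"
    and triv: "\<And>B. B \<in> sets borel \<Longrightarrow> prob (u -` B \<inter> space M) = 0 \<or> prob (u -` B \<inter> space M) = 1"
  shows "AE x in M. u x = expectation u"
proof -
  have [measurable]: "u \<in> borel_measurable M" using u by auto
  define a where "a = expectation u"
  have "\<not> (AE x in M. a < u x)"
  proof
    assume *: "AE x in M. a < u x"
    have "0 < expectation (\<lambda>x. u x - a)"
      using u * by (intro integral_less_AE_space[of "\<lambda>_. 0", simplified]) (auto simp: emeasure_space_1 simp del: integral_diff)
    then show False using u by (simp add: a_def prob_space)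
  qed
  moreover have "\<not> (AE x in M. u x < a)"
  proof
    assume *: "AE x in M. u x < a"
    have "0 < expectation (\<lambda>x. a - u x)"
      using u * by (intro integral_less_AE_space[of "\<lambda>_. 0", simplified]) (auto simp: emeasure_space_1 simp del: integral_diff)
    then show False using u by (simp add: a_def prob_space)
  qed
  ultimately have ne: "prob {x \<in> space M. a < u x} \<noteq> 1" "prob {x \<in> space M. u x < a} \<noteq> 1"
    by (simp_all add: prob_Collect_eq_1)
  have sets_eq: "u -` {a<..} \<inter> space M = {x \<in> space M. a < u x}"
      "u -` {..<a} \<inter> space M = {x \<in> space M. u x < a}" by auto
  have "AE x in M. \<not> a < u x" "AE x in M. \<not> u x < a"
    using triv[of "{a<..}"] triv[of "{..<a}"] ne unfolding sets_eq by (simp_all add: prob_Collect_eq_0)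
  then show ?thesis
    by eventually_elim (simp add: a_def)
qed

text \<open>Nonnegativity of the variance of the absolute value.\<close>

lemma (in prob_space) expectation_abs_le_sqrt:
  fixes u :: "'a \<Rightarrow> real"
  assumes u: "integrable M u" "integrable M (\<lambda>x. (u x)\<^sup>2)"
  shows "expectation (\<lambda>x. \<bar>u x\<bar>) \<le> sqrt (expectation (\<lambda>x. (u x)\<^sup>2))"
proof -
  have "(expectation (\<lambda>x. \<bar>u x\<bar>))\<^sup>2 \<le> expectation (\<lambda>x. \<bar>u x\<bar>\<^sup>2)"
    using variance_positive[of "\<lambda>x. \<bar>u x\<bar>"] variance_eq[of "\<lambda>x. \<bar>u x\<bar>"] u by simp
  then show ?thesis by (simp add: real_le_rsqrt)
qed

text \<open>Completeness of L^1 along a geometrically fast sequence. The increments have summable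
  L^1 norms, so their series converges absolutely almost everywhere; \<open>U\<close> is its sum
  started at \<open>u 0\<close>, and the series of absolute values dominates the remainders.\<close>

lemma L1_limit_of_fast_Cauchy:
  fixes u :: "nat \<Rightarrow> 'a \<Rightarrow> real"
  assumes int: "\<And>k. integrable M (u k)"
    and fast: "\<And>k. (\<integral>x. \<bar>u (Suc k) x - u k x\<bar> \<partial>M) \<le> (1/2) ^ k"
  obtains U where "integrable M U" "(\<lambda>k. \<integral>x. \<bar>u k x - U x\<bar> \<partial>M) \<longlonglongrightarrow> 0"
proof -
  define h where "h k x = u (Suc k) x - u k x" for k x
  define U where "U x = u 0 x + (suminf (\<lambda>k. h k x))" for x
  have h: "integrable M (h k)" for k
    unfolding h_def using int by simp
  have h_norm: "(\<integral>x. norm (h k x) \<partial>M) \<le> (1/2) ^ k" for k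
    using fast by (simp add: h_def)
  have sum_int: "summable (\<lambda>k. \<integral>x. norm (h k x) \<partial>M)"
    by (rule summable_comparison_test[OF _ summable_geometric[of "1/2 :: real"]])
       (use h_norm in \<open>auto intro!: exI[of _ 0]\<close>)
  have "(\<integral>\<^sup>+x. (suminf (\<lambda>k. ennreal (norm (h k x)))) \<partial>M) = (suminf (\<lambda>k. \<integral>\<^sup>+x. ennreal (norm (h k x)) \<partial>M))"
    using h by (intro nn_integral_suminf) auto
  also have "\<dots> = (suminf (\<lambda>k. ennreal (\<integral>x. norm (h k x) \<partial>M)))"
    using h by (simp add: nn_integral_eq_integral)
  also have "\<dots> \<noteq> \<infinity>"
    using sum_int by (simp add: suminf_ennreal2)
  finally have "AE x in M. (suminf (\<lambda>k. ennreal (norm (h k x)))) \<noteq> \<infinity>"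
    using h by (intro nn_integral_PInf_AE) auto
  then have AE_sum: "AE x in M. summable (\<lambda>k. norm (h k x))"
    by eventually_elim (auto intro!: summable_suminf_not_top)
  have intS: "integrable M (\<lambda>x. suminf (\<lambda>k. h k x))"
    by (rule integrable_suminf[OF h AE_sum sum_int])
  have intN: "integrable M (\<lambda>x. suminf (\<lambda>k. norm (h k x)))"
    by (rule integrable_suminf) (use h AE_sum sum_int in auto)
  have U: "integrable M U"
    unfolding U_def using int intS by simp
  have tele: "u n x = u 0 x + (\<Sum>k<n. h k x)" for n x
    by (induction n) (simp_all add: h_def)
  have "(\<lambda>n. \<integral>x. \<bar>u n x - U x\<bar> \<partial>M) \<longlonglongrightarrow> (\<integral>x. 0 \<partial>M)"
  proof (rule integral_dominated_convergence[where w = "\<lambda>x. suminf (\<lambda>k. norm (h k x))"])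
    show "AE x in M. (\<lambda>n. \<bar>u n x - U x\<bar>) \<longlonglongrightarrow> 0"
      using AE_sum
    proof eventually_elim
      case (elim x)
      have "(\<lambda>n. (\<Sum>k<n. h k x)) \<longlonglongrightarrow> (suminf (\<lambda>k. h k x))"
        using summable_LIMSEQ[OF summable_norm_cancel[OF elim]] .
      then have "(\<lambda>n. u n x - U x) \<longlonglongrightarrow> 0"
        by (subst tele) (simp add: U_def LIM_zero)
      then show ?case by (rule tendsto_rabs_zero)
    qed
    fix n
    show "AE x in M. norm \<bar>u n x - U x\<bar> \<le> (suminf (\<lambda>k. norm (h k x)))"
      using AE_sum
    proof eventually_elim
      case (elim x)
      have s: "summable (\<lambda>k. h k x)" by (rule summable_norm_cancel[OF elim])
      have "U x - u n x = (suminf (\<lambda>k. h (k + n) x))"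
        using suminf_minus_initial_segment[OF s, of n] by (subst tele) (simp add: U_def)
      also have "\<bar>\<dots>\<bar> \<le> (suminf (\<lambda>k. norm (h (k + n) x)))"
        using summable_norm[of "\<lambda>k. h (k + n) x"] summable_ignore_initial_segment[OF elim, of n] by simp
      also have "\<dots> = (suminf (\<lambda>k. norm (h k x))) - (\<Sum>k<n. norm (h k x))"
        by (rule suminf_minus_initial_segment[OF elim])
      also have "\<dots> \<le> (suminf (\<lambda>k. norm (h k x)))"
        by (simp add: sum_nonneg)
      finally show ?case by simp
    qed
  qed (use int U intN in auto)
  then show thesis using U by (intro that) simp_all
qed

text \<open>The cutoff variable \<open>g\<close> is separate from the integrand because
  \<open>moment_fun_upd\<close> cuts where the dominating function of one particle number is large,
  and integrates that of another.\<close>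

lemma tendsto_truncation_L1:
  fixes f :: "'a \<Rightarrow> real"
  assumes "integrable M f" and "g \<in> borel_measurable M"
  shows "(\<lambda>k. \<integral>x. \<bar>f x\<bar> * indicator {x. real k < g x} x \<partial>M) \<longlonglongrightarrow> 0"
proof -
  have "(\<lambda>k. \<integral>x. \<bar>f x\<bar> * indicator {x. real k < g x} x \<partial>M) \<longlonglongrightarrow> (\<integral>x. 0 \<partial>M)"
  proof (rule integral_dominated_convergence[where w = "\<lambda>x. \<bar>f x\<bar>"])
    show "AE x in M. (\<lambda>k. \<bar>f x\<bar> * indicator {x. real k < g x} x) \<longlonglongrightarrow> 0"
    proof (rule AE_I2)
      fix x
      obtain k0 where "g x \<le> real k0" using real_arch_simple by blast
      then have "\<bar>f x\<bar> * indicator {x. real k < g x} x = 0" if "k0 \<le> k" for k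
        using that by auto
      then show "(\<lambda>k. \<bar>f x\<bar> * indicator {x. real k < g x} x) \<longlonglongrightarrow> 0"
        by (intro tendsto_eventually) (auto simp: eventually_sequentially)
    qed
    fix k
    have "(\<lambda>x. if real k < g x then \<bar>f x\<bar> else 0) \<in> borel_measurable M"
      using assms by measurable
    then show "(\<lambda>x. \<bar>f x\<bar> * indicator {x. real k < g x} x) \<in> borel_measurable M"
      by (rule measurable_cong[THEN iffD1, rotated]) (simp split: split_indicator)
    show "AE x in M. norm (\<bar>f x\<bar> * indicator {x. real k < g x} x) \<le> \<bar>f x\<bar>"
      by (rule AE_I2) (simp split: split_indicator)
  qed (use assms in auto)
  then show ?thesis by simp
qed

section \<open>Stationary Markov processes\<close>

lemma space_path_space: "space (path_space S) = {0..} \<rightarrow>\<^sub>E space S"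
  by (simp add: path_space_def space_PiM)

lemma measurable_path_component:
  assumes "0 \<le> t"
  shows "(\<lambda>\<omega>. \<omega> t) \<in> path_space S \<rightarrow>\<^sub>M S"
  unfolding path_space_def using assms by (intro measurable_component_singleton) simp

lemma measurable_time_shift:
  assumes "0 \<le> r"
  shows "time_shift r \<in> path_space S \<rightarrow>\<^sub>M path_space S"
  unfolding time_shift_def path_space_def using assms
  by (intro measurable_restrict measurable_component_singleton) simp

lemma time_shift_apply: "0 \<le> t \<Longrightarrow> time_shift r \<omega> t = \<omega> (r + t)"
  by (simp add: time_shift_def)

locale stationary_markov =
  fixes S :: "'s measure" and P :: "'s \<Rightarrow> (real \<Rightarrow> 's) measure" and \<mu> :: "'s measure"
  assumes process: "markov_process S P"
    and stat: "stationary S P \<mu>"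
begin

definition law :: "(real \<Rightarrow> 's) measure" where
  "law = \<mu> \<bind> P"

sublocale initial: prob_space \<mu>
  using stat by (simp add: stationary_def)

lemma sets_initial: "sets \<mu> = sets S"
  using stat by (simp add: stationary_def)

lemma space_initial: "space \<mu> = space S"
  using sets_initial by (rule sets_eq_imp_space_eq)

lemma kernel: "P \<in> \<mu> \<rightarrow>\<^sub>M prob_algebra (path_space S)"
  using process unfolding markov_process_def
  by (simp add: measurable_cong_sets[OF sets_initial refl])

lemma initial_in_prob_algebra: "\<mu> \<in> space (prob_algebra \<mu>)"
  by (simp add: space_prob_algebra initial.prob_space_axioms)

lemma sets_law: "sets law = sets (path_space S)"
  unfolding law_def by (rule sets_bind'[OF initial_in_prob_algebra kernel])

lemma space_law: "space law = space (path_space S)"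
  using sets_law by (rule sets_eq_imp_space_eq)

sublocale law: prob_space law
  unfolding law_def by (rule prob_space_bind'[OF initial_in_prob_algebra kernel])

lemma
  assumes "x \<in> space S"
  shows prob_space_kernel: "prob_space (P x)"
    and sets_kernel: "sets (P x) = sets (path_space S)"
    and space_kernel: "space (P x) = space (path_space S)"
proof -
  have "P x \<in> space (prob_algebra (path_space S))"
    using measurable_space[OF kernel, of x] assms by (simp add: space_initial)
  then show "prob_space (P x)" and *: "sets (P x) = sets (path_space S)"
    by (simp_all add: space_prob_algebra)
  show "space (P x) = space (path_space S)"
    using * by (rule sets_eq_imp_space_eq)
qed

lemma measurable_law_component: "0 \<le> t \<Longrightarrow> (\<lambda>\<omega>. \<omega> t) \<in> law \<rightarrow>\<^sub>M S"
  using measurable_path_component by (simp add: measurable_cong_sets[OF sets_law refl])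

lemma distr_law_component: "0 \<le> t \<Longrightarrow> distr law S (\<lambda>\<omega>. \<omega> t) = \<mu>"
  using stat by (simp add: stationary_def law_def)

lemma
  fixes f :: "'s \<Rightarrow> real"
  assumes t: "0 \<le> t" and f: "integrable \<mu> f"
  shows integrable_law_component: "integrable law (\<lambda>\<omega>. f (\<omega> t))"
    and integral_law_component: "(\<integral>\<omega>. f (\<omega> t) \<partial>law) = (\<integral>\<eta>. f \<eta> \<partial>\<mu>)"
proof -
  have "f \<in> borel_measurable S"
    using borel_measurable_integrable[OF f] by (simp add: measurable_cong_sets[OF sets_initial refl])
  then show "integrable law (\<lambda>\<omega>. f (\<omega> t))" "(\<integral>\<omega>. f (\<omega> t) \<partial>law) = (\<integral>\<eta>. f \<eta> \<partial>\<mu>)"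
    using integrable_distr_eq[OF measurable_law_component[OF t], of f]
      integral_distr[OF measurable_law_component[OF t], of f] f
    by (simp_all add: distr_law_component[OF t])
qed

text \<open>Stationarity is assumed for one-time distributions only. The Markov property at time
  \<open>r\<close> lifts it to whole paths: the shifted path is the process restarted from the state
  at time \<open>r\<close>, whose law is again \<open>\<mu>\<close>.\<close>

lemma distr_law_time_shift:
  assumes r: "0 \<le> r"
  shows "distr law (path_space S) (time_shift r) = law"
proof (rule measure_eqI)
  show "sets (distr law (path_space S) (time_shift r)) = sets law"
    by (simp add: sets_law)
next
  fix B assume "B \<in> sets (distr law (path_space S) (time_shift r))"
  then have B: "B \<in> sets (path_space S)" by simp
  let ?C = "time_shift r -` B \<inter> space (path_space S)"
  have C: "?C \<in> sets (path_space S)"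
    using measurable_sets[OF measurable_time_shift[OF r] B] .
  have shift_law: "time_shift r \<in> law \<rightarrow>\<^sub>M path_space S"
    using measurable_time_shift[OF r] by (simp add: measurable_cong_sets[OF sets_law refl])
  have emeas: "(\<lambda>y. emeasure (P y) B) \<in> borel_measurable S"
    using measurable_emeasure_subprob_algebra[OF B] process
    by (auto simp: markov_process_def intro: measurable_compose dest: measurable_prob_algebraD)
  have comp: "(\<lambda>\<omega>. emeasure (P (\<omega> r)) B) \<in> borel_measurable (path_space S)"
    using measurable_compose[OF measurable_path_component[OF r] emeas] .
  have markov: "emeasure (P x) ?C = (\<integral>\<^sup>+\<omega>. emeasure (P (\<omega> r)) B \<partial>P x)" if x: "x \<in> space S" for x
  proof -
    interpret Px: prob_space "P x" by (rule prob_space_kernel[OF x])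
    \<comment> \<open>The sure event as past event, so that the Markov clause speaks of the future
      alone.\<close>
    let ?A = "space (Pi\<^sub>M {0..r} (\<lambda>_. S))"
    have in_A: "restrict \<omega> {0..r} \<in> ?A" if "\<omega> \<in> space (path_space S)" for \<omega>
      using that by (auto simp: space_path_space space_PiM)
    have in_S: "\<omega> r \<in> space S" if "\<omega> \<in> space (path_space S)" for \<omega>
      using that r by (auto simp: space_path_space)
    have meas: "(\<lambda>\<omega>. measure (P (\<omega> r)) B) \<in> borel_measurable (P x)"
      using comp unfolding measure_def measurable_cong_sets[OF sets_kernel[OF x] refl] by measurable
    have "measure (P x) ?C =
        measure (P x) {\<omega> \<in> space (path_space S). restrict \<omega> {0..r} \<in> ?A \<and> time_shift r \<omega> \<in> B}"
      using in_A by (intro arg_cong[where f = "measure (P x)"]) auto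
    also have "\<dots> = (\<integral>\<omega>. indicator ?A (restrict \<omega> {0..r}) * measure (P (\<omega> r)) B \<partial>P x)"
      using process x r B unfolding markov_process_def by blast
    also have "\<dots> = (\<integral>\<omega>. measure (P (\<omega> r)) B \<partial>P x)"
      using in_A by (intro Bochner_Integration.integral_cong) (auto simp: space_kernel[OF x])
    finally have "emeasure (P x) ?C = ennreal (\<integral>\<omega>. measure (P (\<omega> r)) B \<partial>P x)"
      by (simp add: Px.emeasure_eq_measure)
    also have "\<dots> = (\<integral>\<^sup>+\<omega>. ennreal (measure (P (\<omega> r)) B) \<partial>P x)"
    proof (rule nn_integral_eq_integral[symmetric])
      show "integrable (P x) (\<lambda>\<omega>. measure (P (\<omega> r)) B)"
        using meas in_S by (intro Px.integrable_const_bound[where B = 1])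
          (auto simp: space_kernel[OF x] prob_space.prob_le_1[OF prob_space_kernel] intro!: AE_I2)
    qed simp
    also have "\<dots> = (\<integral>\<^sup>+\<omega>. emeasure (P (\<omega> r)) B \<partial>P x)"
      using in_S by (intro nn_integral_cong)
        (auto simp: space_kernel[OF x]
           finite_measure.emeasure_eq_measure[OF prob_space.finite_measure[OF prob_space_kernel]])
    finally show ?thesis .
  qed
  have "emeasure (distr law (path_space S) (time_shift r)) B = emeasure law ?C"
    using emeasure_distr[OF shift_law B] by (simp add: space_law)
  also have "\<dots> = (\<integral>\<^sup>+x. emeasure (P x) ?C \<partial>\<mu>)"
    unfolding law_def by (rule emeasure_bind_prob_algebra[OF initial_in_prob_algebra kernel C])
  also have "\<dots> = (\<integral>\<^sup>+x. (\<integral>\<^sup>+\<omega>. emeasure (P (\<omega> r)) B \<partial>P x) \<partial>\<mu>)"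
    using markov by (intro nn_integral_cong) (simp add: space_initial)
  also have "\<dots> = (\<integral>\<^sup>+\<omega>. emeasure (P (\<omega> r)) B \<partial>law)"
    unfolding law_def using nn_integral_bind[OF comp measurable_prob_algebraD[OF kernel]] by simp
  also have "\<dots> = (\<integral>\<^sup>+y. emeasure (P y) B \<partial>distr law S (\<lambda>\<omega>. \<omega> r))"
    by (rule nn_integral_distr[OF measurable_law_component[OF r], symmetric]) (use emeas in simp)
  also have "\<dots> = emeasure law B"
    unfolding distr_law_component[OF r] unfolding law_def
    by (rule emeasure_bind_prob_algebra[OF initial_in_prob_algebra kernel B, symmetric])
  finally show "emeasure (distr law (path_space S) (time_shift r)) B = emeasure law B" .
qed

lemma integral_law_time_shift:
  fixes u :: "(real \<Rightarrow> 's) \<Rightarrow> real"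
  assumes r: "0 \<le> r" and u: "u \<in> borel_measurable (path_space S)"
  shows "(\<integral>\<omega>. u (time_shift r \<omega>) \<partial>law) = (\<integral>\<omega>. u \<omega> \<partial>law)"
proof -
  have "time_shift r \<in> law \<rightarrow>\<^sub>M path_space S"
    using measurable_time_shift[OF r] by (simp add: measurable_cong_sets[OF sets_law refl])
  from integral_distr[OF this u] show ?thesis
    by (simp add: distr_law_time_shift[OF r])
qed

text \<open>Under \<open>P x\<close> the path starts in \<open>x\<close> almost surely, so
  \<open>g (\<omega> 0)\<close> leaves the inner integral as \<open>g x\<close>. What remains is the
  expectation at a fixed initial state, the form in which duality is stated.\<close>

lemma integral_law_initial_mult:
  fixes g f :: "'s \<Rightarrow> real"
  assumes t: "0 \<le> t" and g: "g \<in> borel_measurable S" "\<And>x. x \<in> space S \<Longrightarrow> \<bar>g x\<bar> \<le> C"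
    and f: "integrable \<mu> f"
  shows "integrable law (\<lambda>\<omega>. g (\<omega> 0) * f (\<omega> t))"
    and "(\<integral>\<omega>. g (\<omega> 0) * f (\<omega> t) \<partial>law) = (\<integral>x. g x * (\<integral>\<omega>. f (\<omega> t) \<partial>P x) \<partial>\<mu>)"
proof -
  have g0: "(\<lambda>\<omega>. g (\<omega> 0)) \<in> borel_measurable law"
    using measurable_compose[OF measurable_law_component[of 0] g(1)] by simp
  have "integrable law (\<lambda>\<omega>. C * \<bar>f (\<omega> t)\<bar>)"
    using integrable_law_component[OF t f] by simp
  then show int: "integrable law (\<lambda>\<omega>. g (\<omega> 0) * f (\<omega> t))"
  proof (rule Bochner_Integration.integrable_bound)
    show "(\<lambda>\<omega>. g (\<omega> 0) * f (\<omega> t)) \<in> borel_measurable law"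
      using g0 borel_measurable_integrable[OF integrable_law_component[OF t f]] by measurable
    show "AE \<omega> in law. norm (g (\<omega> 0) * f (\<omega> t)) \<le> norm (C * \<bar>f (\<omega> t)\<bar>)"
    proof (rule AE_I2)
      fix \<omega> assume "\<omega> \<in> space law"
      then have "\<bar>g (\<omega> 0)\<bar> \<le> C"
        using g(2) measurable_space[OF measurable_law_component[of 0]] by simp
      then have "\<bar>g (\<omega> 0)\<bar> * \<bar>f (\<omega> t)\<bar> \<le> \<bar>C\<bar> * \<bar>f (\<omega> t)\<bar>"
        by (intro mult_right_mono) auto
      then show "norm (g (\<omega> 0) * f (\<omega> t)) \<le> norm (C * \<bar>f (\<omega> t)\<bar>)"
        by (simp add: abs_mult)
    qed
  qed
  have fS: "f \<in> borel_measurable S"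
    using borel_measurable_integrable[OF f] by (simp add: measurable_cong_sets[OF sets_initial refl])
  have "(\<integral>\<omega>. g (\<omega> 0) * f (\<omega> t) \<partial>law) = (\<integral>x. (\<integral>\<omega>. g (\<omega> 0) * f (\<omega> t) \<partial>P x) \<partial>\<mu>)"
    using integral_bind_integrable[OF kernel initial.not_empty] int unfolding law_def by blast
  also have "\<dots> = (\<integral>x. g x * (\<integral>\<omega>. f (\<omega> t) \<partial>P x) \<partial>\<mu>)"
  proof (rule Bochner_Integration.integral_cong[OF refl])
    fix x assume "x \<in> space \<mu>"
    then have x: "x \<in> space S" by (simp add: space_initial)
    have meas: "(\<lambda>\<omega>. h (\<omega> s)) \<in> borel_measurable (P x)" if "h \<in> borel_measurable S" "0 \<le> s" for h :: "'s \<Rightarrow> real" and s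
      using measurable_compose[OF measurable_path_component[OF that(2)] that(1)]
      by (simp add: measurable_cong_sets[OF sets_kernel[OF x] refl])
    have "AE \<omega> in P x. \<omega> 0 = x"
      using process x by (simp add: markov_process_def)
    then have "(\<integral>\<omega>. g (\<omega> 0) * f (\<omega> t) \<partial>P x) = (\<integral>\<omega>. g x * f (\<omega> t) \<partial>P x)"
      using meas[OF g(1), of 0] meas[OF fS t] by (intro integral_cong_AE) auto
    then show "(\<integral>\<omega>. g (\<omega> 0) * f (\<omega> t) \<partial>P x) = g x * (\<integral>\<omega>. f (\<omega> t) \<partial>P x)"
      by simp
  qed
  finally show "(\<integral>\<omega>. g (\<omega> 0) * f (\<omega> t) \<partial>law) = (\<integral>x. g x * (\<integral>\<omega>. f (\<omega> t) \<partial>P x) \<partial>\<mu>)" .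
qed

end

section \<open>Ergodic averages\<close>

text \<open>Iterated midpoints replace time integrals because paths need not be measurable in time. A
  sequence of averages of nearly minimal \<open>L\<^sup>2\<close> norm converges, and its limit is shift invariant.\<close>

inductive_set time_averages :: "('s \<Rightarrow> real) \<Rightarrow> real \<Rightarrow> ((real \<Rightarrow> 's) \<Rightarrow> real) set"
  for f s where
  single: "s \<le> t \<Longrightarrow> (\<lambda>\<omega>. f (\<omega> t)) \<in> time_averages f s"
| midpoint: "u \<in> time_averages f s \<Longrightarrow> v \<in> time_averages f s \<Longrightarrow>
    (\<lambda>\<omega>. (u \<omega> + v \<omega>) / 2) \<in> time_averages f s"

text \<open>Only a lower bound is put on the times entering an average, so shifting stays inside the
  set. This makes the shift of a near-minimizer again a competitor.\<close>

lemma time_averages_time_shift: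
  assumes "u \<in> time_averages f s" "0 \<le> s" "0 \<le> r"
  shows "(\<lambda>\<omega>. u (time_shift r \<omega>)) \<in> time_averages f s"
  using assms(1)
proof induction
  case (single t)
  then have "(\<lambda>\<omega>. f (time_shift r \<omega> t)) = (\<lambda>\<omega>. f (\<omega> (r + t)))"
    using assms by (simp add: time_shift_apply)
  then show ?case
    using single assms time_averages.single[of s "r + t" f] by simp
next
  case (midpoint u v)
  then show ?case using time_averages.midpoint by fast
qed

lemma time_averages_measurable:
  assumes "u \<in> time_averages f s" "0 \<le> s" "f \<in> borel_measurable S"
  shows "u \<in> borel_measurable (path_space S)"
  using assms(1)
proof induction
  case (single t)
  then show ?case
    using measurable_compose[OF measurable_path_component assms(3)] assms by simp
next
  case (midpoint u v)
  then show ?case by measurable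
qed

lemma time_averages_bounded:
  assumes "u \<in> time_averages f s" "0 \<le> s" "\<And>x. x \<in> space S \<Longrightarrow> \<bar>f x\<bar> \<le> K"
    and "\<omega> \<in> space (path_space S)"
  shows "\<bar>u \<omega>\<bar> \<le> K"
  using assms(1)
proof induction
  case (single t)
  then show ?case
    using measurable_space[OF measurable_path_component, of t \<omega>] assms by simp
next
  case (midpoint u v)
  then show ?case by (simp add: abs_le_iff)
qed

section \<open>The mean ergodic theorem\<close>

context stationary_markov
begin

lemma time_averages_integrable:
  assumes u: "u \<in> time_averages f s" and s: "0 \<le> s" and f: "f \<in> borel_measurable S"
    and K: "\<And>x. x \<in> space S \<Longrightarrow> \<bar>f x\<bar> \<le> K"
  shows "integrable law u"
proof (rule law.integrable_const_bound[where B = K])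
  show "AE \<omega> in law. norm (u \<omega>) \<le> K"
    using time_averages_bounded[OF u s K] by (intro AE_I2) (simp add: space_law)
  show "u \<in> borel_measurable law"
    using time_averages_measurable[OF u s f] by (simp add: measurable_cong_sets[OF sets_law refl])
qed

text \<open>Von Neumann's theorem in its minimal-norm form; the parallelogram law uses midpoints
  alone, so dyadic combinations suffice. A shift preserves the L^2 norm and the set of averages, so
  a minimizing sequence and its shift have the same L^1 limit. Ergodicity makes that limit constant,
  and the constant is the mean shared by all averages.\<close>

lemma time_averages_L1_ergodic:
  assumes erg: "time_ergodic S P \<mu>" and s: "0 \<le> s" and f: "f \<in> borel_measurable S"
    and K: "\<And>x. x \<in> space S \<Longrightarrow> \<bar>f x\<bar> \<le> K" and e: "0 < e"
  obtains u where "u \<in> time_averages f s" "(\<integral>\<omega>. \<bar>u \<omega> - (\<integral>x. f x \<partial>\<mu>)\<bar> \<partial>law) < e"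
proof -
  let ?T = "time_averages f s"
  define N where "N u = (\<integral>\<omega>. (u \<omega>)\<^sup>2 \<partial>law)" for u :: "(real \<Rightarrow> 's) \<Rightarrow> real"
  define m where "m = Inf (N ` ?T)"
  have meas: "u \<in> borel_measurable law" if "u \<in> ?T" for u
    using time_averages_measurable[OF that s f] by (simp add: measurable_cong_sets[OF sets_law refl])
  have bd: "\<bar>u \<omega>\<bar> \<le> K" if "u \<in> ?T" "\<omega> \<in> space law" for u \<omega>
    using time_averages_bounded[OF that(1) s K] that(2) by (simp add: space_law)
  have intT: "integrable law u" if "u \<in> ?T" for u
    by (rule time_averages_integrable[OF that s f K])
  have int_mult: "integrable law (\<lambda>\<omega>. u \<omega> * v \<omega>)" if "u \<in> ?T" "v \<in> ?T" for u v
  proof (rule law.integrable_const_bound[where B = "K * K"])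
    show "AE \<omega> in law. norm (u \<omega> * v \<omega>) \<le> K * K"
      using bd[OF that(1)] bd[OF that(2)] by (intro AE_I2) (auto simp: abs_mult intro!: mult_mono' order_trans[OF abs_ge_zero])
  qed (use meas that in measurable)
  have sq: "integrable law (\<lambda>\<omega>. (u \<omega>)\<^sup>2)" if "u \<in> ?T" for u
    using int_mult[OF that that] by (simp add: power2_eq_square)
  have m_le: "m \<le> N u" if "u \<in> ?T" for u
    unfolding m_def using that by (intro cInf_lower bdd_belowI[of _ 0]) (auto simp: N_def)
  text \<open>The parallelogram law: the midpoint of two averages is an average, of squared norm at least \<open>m\<close>.\<close>
  have close: "(\<integral>\<omega>. \<bar>u \<omega> - v \<omega>\<bar> \<partial>law) \<le> sqrt (4 * \<delta>)"
    if uv: "u \<in> ?T" "v \<in> ?T" "N u \<le> m + \<delta>" "N v \<le> m + \<delta>" for u v \<delta>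
  proof -
    have mid: "(\<lambda>\<omega>. (u \<omega> + v \<omega>) / 2) \<in> ?T"
      using uv by (intro time_averages.midpoint)
    have "(\<integral>\<omega>. (u \<omega> - v \<omega>)\<^sup>2 \<partial>law)
        = (\<integral>\<omega>. 2 * (u \<omega>)\<^sup>2 + 2 * (v \<omega>)\<^sup>2 - 4 * ((u \<omega> + v \<omega>) / 2)\<^sup>2 \<partial>law)"
      by (intro Bochner_Integration.integral_cong refl) (simp add: power2_eq_square field_simps)
    also have "\<dots> = 2 * N u + 2 * N v - 4 * N (\<lambda>\<omega>. (u \<omega> + v \<omega>) / 2)"
      unfolding N_def using sq[OF uv(1)] sq[OF uv(2)] sq[OF mid] by (simp del: power_divide)
    also have "\<dots> \<le> 4 * \<delta>"
      using uv m_le[OF mid] by simp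
    finally have le: "sqrt (\<integral>\<omega>. (u \<omega> - v \<omega>)\<^sup>2 \<partial>law) \<le> sqrt (4 * \<delta>)"
      by simp
    have "integrable law (\<lambda>\<omega>. (u \<omega> - v \<omega>)\<^sup>2)"
      unfolding power2_diff using sq[OF uv(1)] sq[OF uv(2)] int_mult[OF uv(1,2)] by (simp add: mult.assoc)
    then have "(\<integral>\<omega>. \<bar>u \<omega> - v \<omega>\<bar> \<partial>law) \<le> sqrt (\<integral>\<omega>. (u \<omega> - v \<omega>)\<^sup>2 \<partial>law)"
      using intT[OF uv(1)] intT[OF uv(2)] by (intro law.expectation_abs_le_sqrt) auto
    then show ?thesis using le by (rule order_trans)
  qed
  have "\<exists>u\<in>?T. N u \<le> m + \<delta>" if "0 < \<delta>" for \<delta>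
  proof -
    have "N ` ?T \<noteq> {}" using time_averages.single[of s s f] by auto
    then show ?thesis
      using cInf_lessD[of "N ` ?T" "m + \<delta>"] that by (auto simp: m_def intro: less_imp_le)
  qed
  \<comment> \<open>The excess over \<open>m\<close> is chosen so that \<open>close\<close> yields
    exactly the rate \<open>(1/2) ^ k\<close> that \<open>L1_limit_of_fast_Cauchy\<close> asks
    for.\<close>
  then have "\<forall>k. \<exists>u. u \<in> ?T \<and> N u \<le> m + (1/4) ^ Suc k"
    by (metis zero_less_power zero_less_divide_1_iff zero_less_numeral)
  then obtain u where u: "\<And>k. u k \<in> ?T" and Nu: "\<And>k. N (u k) \<le> m + (1/4) ^ Suc k"
    by metis
  have sqrt_eq: "sqrt (4 * (1/4) ^ Suc k) = (1/2) ^ k" for k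
    by (simp add: real_sqrt_power real_sqrt_divide)
  have "(\<integral>\<omega>. \<bar>u (Suc k) \<omega> - u k \<omega>\<bar> \<partial>law) \<le> (1/2) ^ k" for k
  proof -
    have "N (u (Suc k)) \<le> m + (1/4) ^ Suc k"
      using Nu[of "Suc k"] by (rule order_trans) (simp add: power_decreasing)
    from close[OF u u this Nu[of k]] show ?thesis unfolding sqrt_eq .
  qed
  from L1_limit_of_fast_Cauchy[OF intT[OF u] this]
  obtain U where U: "integrable law U" and lim: "(\<lambda>k. \<integral>\<omega>. \<bar>u k \<omega> - U \<omega>\<bar> \<partial>law) \<longlonglongrightarrow> 0"
    by blast
  have U_path: "U \<in> borel_measurable (path_space S)"
    using borel_measurable_integrable[OF U] by (simp add: measurable_cong_sets[OF sets_law refl])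
  have invariant: "AE \<omega> in law. U (time_shift r \<omega>) = U \<omega>" if r: "0 \<le> r" for r
  proof -
    define u' where "u' k \<omega> = u k (time_shift r \<omega>)" for k \<omega>
    have u': "u' k \<in> ?T" for k
      unfolding u'_def using time_averages_time_shift[OF u s r] .
    have Nu': "N (u' k) = N (u k)" for k
      unfolding N_def u'_def
      using time_averages_measurable[OF u s f]
      by (intro integral_law_time_shift[OF r, of "\<lambda>\<omega>. (u k \<omega>)\<^sup>2"]) measurable
    have shift_law: "time_shift r \<in> law \<rightarrow>\<^sub>M path_space S"
      using measurable_time_shift[OF r] by (simp add: measurable_cong_sets[OF sets_law refl])
    have U': "integrable law (\<lambda>\<omega>. U (time_shift r \<omega>))"
      using integrable_distr[OF shift_law, of U] U by (simp add: distr_law_time_shift[OF r])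
    have dist': "(\<integral>\<omega>. \<bar>u' k \<omega> - U (time_shift r \<omega>)\<bar> \<partial>law) = (\<integral>\<omega>. \<bar>u k \<omega> - U \<omega>\<bar> \<partial>law)" for k
      unfolding u'_def
      using time_averages_measurable[OF u s f] U_path
      by (intro integral_law_time_shift[OF r, of "\<lambda>\<omega>. \<bar>u k \<omega> - U \<omega>\<bar>"]) measurable
    \<comment> \<open>Triangle inequality through \<open>u' k\<close> and \<open>u k\<close>: the
      two outer distances agree by shift invariance of \<open>law\<close>, and the middle one is
      small because both averages are nearly minimal.\<close>
    have "(\<integral>\<omega>. \<bar>U (time_shift r \<omega>) - U \<omega>\<bar> \<partial>law) \<le> 2 * (\<integral>\<omega>. \<bar>u k \<omega> - U \<omega>\<bar> \<partial>law) + (1/2) ^ k" for k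
    proof -
      have "(\<integral>\<omega>. \<bar>U (time_shift r \<omega>) - U \<omega>\<bar> \<partial>law)
          \<le> (\<integral>\<omega>. \<bar>u' k \<omega> - U (time_shift r \<omega>)\<bar> + (\<bar>u' k \<omega> - u k \<omega>\<bar> + \<bar>u k \<omega> - U \<omega>\<bar>) \<partial>law)"
        using U U' intT[OF u] intT[OF u'] by (intro integral_mono) auto
      also have "\<dots> = (\<integral>\<omega>. \<bar>u' k \<omega> - U (time_shift r \<omega>)\<bar> \<partial>law)
          + ((\<integral>\<omega>. \<bar>u' k \<omega> - u k \<omega>\<bar> \<partial>law) + (\<integral>\<omega>. \<bar>u k \<omega> - U \<omega>\<bar> \<partial>law))"
        using U U' intT[OF u] intT[OF u'] by simp
      also have "(\<integral>\<omega>. \<bar>u' k \<omega> - u k \<omega>\<bar> \<partial>law) \<le> (1/2) ^ k"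
        using close[OF u' u, of k "(1/4) ^ Suc k" k] Nu[of k] unfolding Nu' sqrt_eq by simp
      finally show ?thesis by (simp add: dist')
    qed
    moreover have "(\<lambda>k. 2 * (\<integral>\<omega>. \<bar>u k \<omega> - U \<omega>\<bar> \<partial>law) + (1/2) ^ k) \<longlonglongrightarrow> 2 * 0 + 0"
      by (intro tendsto_intros lim LIMSEQ_power_zero) simp
    ultimately have "(\<integral>\<omega>. \<bar>U (time_shift r \<omega>) - U \<omega>\<bar> \<partial>law) \<le> 0"
      by (intro LIMSEQ_le_const[where X = "\<lambda>k. 2 * (\<integral>\<omega>. \<bar>u k \<omega> - U \<omega>\<bar> \<partial>law) + (1/2) ^ k"]) auto
    then have "(\<integral>\<omega>. \<bar>U (time_shift r \<omega>) - U \<omega>\<bar> \<partial>law) = 0"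
      by (simp add: antisym)
    then have "AE \<omega> in law. \<bar>U (time_shift r \<omega>) - U \<omega>\<bar> = 0"
      using U U' by (subst (asm) integral_nonneg_eq_0_iff_AE) auto
    then show ?thesis by eventually_elim simp
  qed
  have "AE \<omega> in law. U \<omega> = (\<integral>\<omega>. U \<omega> \<partial>law)"
  proof (rule law.AE_eq_expectation_of_level_sets_trivial[OF U])
    fix B :: "real set" assume B: "B \<in> sets borel"
    let ?A = "U -` B \<inter> space law"
    have A: "?A \<in> sets (path_space S)"
      using measurable_sets[OF U_path B] by (simp add: space_law)
    \<comment> \<open>Each \<open>t\<close> has its own null set, which is the form of invariance in
      \<open>time_ergodic\<close>.\<close>
    have "AE \<omega> in law. time_shift t \<omega> \<in> ?A \<longleftrightarrow> \<omega> \<in> ?A" if t: "0 \<le> t" for t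
      using invariant[OF t] AE_space
    proof eventually_elim
      case (elim \<omega>)
      then show ?case
        using measurable_space[OF measurable_time_shift[OF t], of \<omega> S] by (simp add: space_law)
    qed
    then show "law.prob ?A = 0 \<or> law.prob ?A = 1"
      using erg A unfolding time_ergodic_def law_def[symmetric] by blast
  qed
  moreover have "(\<integral>\<omega>. U \<omega> \<partial>law) = (\<integral>x. f x \<partial>\<mu>)"
  proof -
    have mean: "(\<integral>\<omega>. v \<omega> \<partial>law) = (\<integral>x. f x \<partial>\<mu>)" if "v \<in> ?T" for v
      using that
    proof induction
      case (single t)
      have "integrable \<mu> f"
        using f K by (intro initial.integrable_const_bound[where B = K])
          (auto simp: space_initial measurable_cong_sets[OF sets_initial refl] intro!: AE_I2)
      then show ?case
        using single s by (intro integral_law_component) auto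
    next
      case (midpoint u v)
      then show ?case using intT by simp
    qed
    have "\<bar>(\<integral>\<omega>. U \<omega> \<partial>law) - (\<integral>x. f x \<partial>\<mu>)\<bar> \<le> (\<integral>\<omega>. \<bar>u k \<omega> - U \<omega>\<bar> \<partial>law)" for k
    proof -
      have "(\<integral>\<omega>. U \<omega> \<partial>law) - (\<integral>x. f x \<partial>\<mu>) = - (\<integral>\<omega>. u k \<omega> - U \<omega> \<partial>law)"
        using U intT[OF u] mean[OF u] by simp
      then show ?thesis using integral_abs_bound[of law "\<lambda>\<omega>. u k \<omega> - U \<omega>"] by simp
    qed
    then have "\<bar>(\<integral>\<omega>. U \<omega> \<partial>law) - (\<integral>x. f x \<partial>\<mu>)\<bar> \<le> 0"
      by (intro LIMSEQ_le_const[OF lim]) auto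
    then show ?thesis by simp
  qed
  ultimately have AE_U: "AE \<omega> in law. U \<omega> = (\<integral>x. f x \<partial>\<mu>)"
    by simp
  have "eventually (\<lambda>k. (\<integral>\<omega>. \<bar>u k \<omega> - U \<omega>\<bar> \<partial>law) < e) sequentially"
    using order_tendstoD(2)[OF lim e] .
  then obtain k where k: "(\<integral>\<omega>. \<bar>u k \<omega> - U \<omega>\<bar> \<partial>law) < e"
    by (auto simp: eventually_sequentially)
  have "(\<integral>\<omega>. \<bar>u k \<omega> - U \<omega>\<bar> \<partial>law) = (\<integral>\<omega>. \<bar>u k \<omega> - (\<integral>x. f x \<partial>\<mu>)\<bar> \<partial>law)"
    using U meas[OF u] by (intro integral_cong_AE) (use AE_U in \<open>auto\<close>)
  with k show thesis by (intro that[OF u[of k]]) simp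
qed

section \<open>Correlations over long times\<close>

text \<open>The hypothesis \<open>near\<close> is convex in the second factor, so it passes from
  single times after \<open>s\<close> to every average of such times. Some average is L^1-close to
  the constant mean of \<open>f\<close>, and the bounded factor \<open>g\<close> carries this
  closeness over to the correlation.\<close>

lemma decorrelation_bounded:
  fixes f g :: "'s \<Rightarrow> real"
  assumes erg: "time_ergodic S P \<mu>"
    and g: "g \<in> borel_measurable S" "\<And>x. x \<in> space S \<Longrightarrow> \<bar>g x\<bar> \<le> C"
    and f: "f \<in> borel_measurable S" "\<And>x. x \<in> space S \<Longrightarrow> \<bar>f x\<bar> \<le> K"
    and s: "0 \<le> s"
    and near: "\<And>t. s \<le> t \<Longrightarrow> \<bar>(\<integral>\<omega>. g (\<omega> 0) * f (\<omega> t) \<partial>law) - L\<bar> \<le> e"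
  shows "\<bar>(\<integral>x. g x \<partial>\<mu>) * (\<integral>x. f x \<partial>\<mu>) - L\<bar> \<le> e"
proof -
  let ?c = "\<integral>x. f x \<partial>\<mu>"
  have bounded_integrable: "integrable \<mu> h"
    if "h \<in> borel_measurable S" "\<And>x. x \<in> space S \<Longrightarrow> \<bar>h x\<bar> \<le> B" for h :: "'s \<Rightarrow> real" and B
    using that by (intro initial.integrable_const_bound[where B = B])
      (auto simp: space_initial measurable_cong_sets[OF sets_initial refl] intro!: AE_I2)
  have g_bound: "\<bar>g (\<omega> 0)\<bar> \<le> C" if "\<omega> \<in> space law" for \<omega>
    using g(2) measurable_space[OF measurable_law_component[of 0] that] by simp
  have g_meas: "(\<lambda>\<omega>. g (\<omega> 0)) \<in> borel_measurable law"
    using measurable_compose[OF measurable_law_component g(1)] by simp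
  have C: "0 \<le> C"
  proof -
    obtain \<omega> where "\<omega> \<in> space law" using law.not_empty by blast
    from order_trans[OF abs_ge_zero g_bound[OF this]] show ?thesis .
  qed
  have int_g: "integrable law (\<lambda>\<omega>. g (\<omega> 0) * v \<omega>)" if v: "integrable law v" for v :: "(real \<Rightarrow> 's) \<Rightarrow> real"
  proof (rule Bochner_Integration.integrable_bound[of _ "\<lambda>\<omega>. C * v \<omega>"])
    show "AE \<omega> in law. norm (g (\<omega> 0) * v \<omega>) \<le> norm (C * v \<omega>)"
      using g_bound C by (intro AE_I2) (simp add: abs_mult mult_right_mono)
  qed (use v g_meas in auto)
  have avg: "\<bar>(a + b) / 2 - L\<bar> \<le> e" if "\<bar>a - L\<bar> \<le> e" "\<bar>b - L\<bar> \<le> e" for a b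
    using that unfolding abs_le_iff by (simp add: field_simps)
  have near_avg: "\<bar>(\<integral>\<omega>. g (\<omega> 0) * u \<omega> \<partial>law) - L\<bar> \<le> e" if "u \<in> time_averages f s" for u
    using that
  proof induction
    case (single t)
    then show ?case by (rule near)
  next
    case (midpoint u v)
    have "integrable law (\<lambda>\<omega>. g (\<omega> 0) * u \<omega>)" "integrable law (\<lambda>\<omega>. g (\<omega> 0) * v \<omega>)"
      using midpoint time_averages_integrable[OF _ s f] int_g by blast+
    then have eq: "(\<integral>\<omega>. g (\<omega> 0) * ((u \<omega> + v \<omega>) / 2) \<partial>law)
        = ((\<integral>\<omega>. g (\<omega> 0) * u \<omega> \<partial>law) + (\<integral>\<omega>. g (\<omega> 0) * v \<omega> \<partial>law)) / 2"
      by (simp add: distrib_left)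
    show ?case unfolding eq by (rule avg[OF midpoint.IH])
  qed
  have "\<bar>(\<integral>x. g x \<partial>\<mu>) * ?c - L\<bar> \<le> e + C * \<delta>" if \<delta>: "0 < \<delta>" for \<delta>
  proof -
    obtain u where u: "u \<in> time_averages f s" "(\<integral>\<omega>. \<bar>u \<omega> - ?c\<bar> \<partial>law) < \<delta>"
      using time_averages_L1_ergodic[OF erg s f \<delta>] by blast
    have iu: "integrable law u" by (rule time_averages_integrable[OF u(1) s f])
    have g0: "(\<integral>\<omega>. g (\<omega> 0) \<partial>law) = (\<integral>x. g x \<partial>\<mu>)"
      using integral_law_component[of 0 g] bounded_integrable[OF g] by simp
    have "(\<integral>\<omega>. g (\<omega> 0) * u \<omega> \<partial>law) - (\<integral>x. g x \<partial>\<mu>) * ?c = (\<integral>\<omega>. g (\<omega> 0) * (u \<omega> - ?c) \<partial>law)"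
      using int_g[OF iu] int_g[of "\<lambda>_. ?c"] g0 by (simp add: right_diff_distrib)
    also have "\<bar>\<dots>\<bar> \<le> (\<integral>\<omega>. \<bar>g (\<omega> 0) * (u \<omega> - ?c)\<bar> \<partial>law)"
      by simp
    also have "\<dots> \<le> (\<integral>\<omega>. C * \<bar>u \<omega> - ?c\<bar> \<partial>law)"
    proof (rule integral_mono)
      show "integrable law (\<lambda>\<omega>. \<bar>g (\<omega> 0) * (u \<omega> - ?c)\<bar>)"
        using iu by (intro integrable_abs int_g) simp
      show "\<bar>g (\<omega> 0) * (u \<omega> - ?c)\<bar> \<le> C * \<bar>u \<omega> - ?c\<bar>" if "\<omega> \<in> space law" for \<omega>
        using g_bound[OF that] by (simp add: abs_mult mult_right_mono)
    qed (use iu in simp)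
    also have "\<dots> \<le> C * \<delta>"
      using u(2) C by (simp add: mult_left_mono)
    finally show ?thesis using near_avg[OF u(1)] by linarith
  qed
  then have *: "\<bar>(\<integral>x. g x \<partial>\<mu>) * ?c - L\<bar> \<le> e + C * (1 / real (Suc n))" for n
    by this simp
  have "(\<lambda>n. e + C * (1 / real (Suc n))) \<longlonglongrightarrow> e + C * 0"
    by (intro tendsto_intros) (use LIMSEQ_inverse_real_of_nat in \<open>simp add: inverse_eq_divide\<close>)
  from LIMSEQ_le_const[OF this] * show ?thesis by auto
qed

text \<open>Truncating \<open>f\<close> at level \<open>k\<close> changes the correlation by at most
  \<open>C * \<delta> k\<close> at every time, by stationarity. So \<open>near\<close> survives the
  truncation with a slightly larger error, the bounded case applies, and the excess vanishes as
  \<open>k\<close> grows.\<close>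

lemma decorrelation:
  fixes f g :: "'s \<Rightarrow> real"
  assumes erg: "time_ergodic S P \<mu>"
    and g: "g \<in> borel_measurable S" "\<And>x. x \<in> space S \<Longrightarrow> \<bar>g x\<bar> \<le> C"
    and f: "integrable \<mu> f"
    and s: "0 \<le> s"
    and near: "\<And>t. s \<le> t \<Longrightarrow> \<bar>(\<integral>\<omega>. g (\<omega> 0) * f (\<omega> t) \<partial>law) - L\<bar> \<le> e"
  shows "\<bar>(\<integral>x. g x \<partial>\<mu>) * (\<integral>x. f x \<partial>\<mu>) - L\<bar> \<le> e"
proof -
  have [measurable]: "f \<in> borel_measurable S"
    using borel_measurable_integrable[OF f] by (simp add: measurable_cong_sets[OF sets_initial refl])
  have C: "0 \<le> C"
  proof -
    obtain x where "x \<in> space S" using initial.not_empty space_initial by blast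
    from order_trans[OF abs_ge_zero g(2)[OF this]] show ?thesis .
  qed
  define trunc where "trunc k x = (if \<bar>f x\<bar> \<le> real k then f x else 0)" for k x
  define \<delta> where "\<delta> k = (\<integral>x. \<bar>f x\<bar> * indicator {x. real k < \<bar>f x\<bar>} x \<partial>\<mu>)" for k
  have \<delta>: "\<delta> \<longlonglongrightarrow> 0"
    unfolding \<delta>_def using f by (intro tendsto_truncation_L1) auto
  have trunc_meas: "trunc k \<in> borel_measurable S" for k
    unfolding trunc_def by measurable
  have trunc_bound: "\<bar>trunc k x\<bar> \<le> real k" for k x
    by (simp add: trunc_def)
  have trunc_int: "integrable \<mu> (trunc k)" for k
    using trunc_meas[of k] trunc_bound[of k]
    by (intro initial.integrable_const_bound[where B = "real k"])
      (auto simp: measurable_cong_sets[OF sets_initial refl])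
  have dist: "(\<integral>x. \<bar>trunc k x - f x\<bar> \<partial>\<mu>) = \<delta> k" for k
    unfolding \<delta>_def trunc_def
    by (intro Bochner_Integration.integral_cong) (auto split: split_indicator)
  have near_k: "\<bar>(\<integral>x. g x \<partial>\<mu>) * (\<integral>x. trunc k x \<partial>\<mu>) - L\<bar> \<le> e + C * \<delta> k" for k
  proof (rule decorrelation_bounded[OF erg g trunc_meas trunc_bound s])
    fix t assume t: "s \<le> t"
    then have t0: "0 \<le> t" using s by simp
    have int: "integrable law (\<lambda>\<omega>. g (\<omega> 0) * h (\<omega> t))" if "integrable \<mu> h" for h
      by (rule integral_law_initial_mult(1)[OF t0 g]) (use that in auto)
    have "(\<integral>\<omega>. g (\<omega> 0) * trunc k (\<omega> t) \<partial>law) - (\<integral>\<omega>. g (\<omega> 0) * f (\<omega> t) \<partial>law)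
        = (\<integral>\<omega>. g (\<omega> 0) * (trunc k (\<omega> t) - f (\<omega> t)) \<partial>law)"
      using int[OF trunc_int[of k]] int[OF f] by (simp add: right_diff_distrib)
    also have "\<bar>\<dots>\<bar> \<le> (\<integral>\<omega>. \<bar>g (\<omega> 0) * (trunc k (\<omega> t) - f (\<omega> t))\<bar> \<partial>law)"
      by simp
    also have "\<dots> \<le> (\<integral>\<omega>. C * \<bar>trunc k (\<omega> t) - f (\<omega> t)\<bar> \<partial>law)"
    proof (rule integral_mono)
      show "integrable law (\<lambda>\<omega>. \<bar>g (\<omega> 0) * (trunc k (\<omega> t) - f (\<omega> t))\<bar>)"
        using int[OF Bochner_Integration.integrable_diff[OF trunc_int[of k] f]] by simp
      show "integrable law (\<lambda>\<omega>. C * \<bar>trunc k (\<omega> t) - f (\<omega> t)\<bar>)"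
        using integrable_law_component[OF t0 Bochner_Integration.integrable_diff[OF trunc_int[of k] f]] by simp
      fix \<omega> assume "\<omega> \<in> space law"
      then have "\<bar>g (\<omega> 0)\<bar> \<le> C"
        using g(2) measurable_space[OF measurable_law_component[of 0]] by simp
      then show "\<bar>g (\<omega> 0) * (trunc k (\<omega> t) - f (\<omega> t))\<bar> \<le> C * \<bar>trunc k (\<omega> t) - f (\<omega> t)\<bar>"
        by (simp add: abs_mult mult_right_mono)
    qed
    also have "\<dots> = C * \<delta> k"
      using integral_law_component[OF t0, of "\<lambda>x. \<bar>trunc k x - f x\<bar>"] trunc_int[of k] f by (simp add: dist)
    finally show "\<bar>(\<integral>\<omega>. g (\<omega> 0) * trunc k (\<omega> t) \<partial>law) - L\<bar> \<le> e + C * \<delta> k"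
      using near[OF t] by linarith
  qed
  have lim: "(\<lambda>k. \<integral>x. trunc k x \<partial>\<mu>) \<longlonglongrightarrow> (\<integral>x. f x \<partial>\<mu>)"
  proof (rule LIM_zero_cancel, rule Lim_null_comparison[OF _ \<delta>], intro always_eventually allI)
    fix k
    have "(\<integral>x. trunc k x \<partial>\<mu>) - (\<integral>x. f x \<partial>\<mu>) = (\<integral>x. trunc k x - f x \<partial>\<mu>)"
      using trunc_int[of k] f by simp
    then show "norm ((\<integral>x. trunc k x \<partial>\<mu>) - (\<integral>x. f x \<partial>\<mu>)) \<le> \<delta> k"
      using integral_abs_bound[of \<mu> "\<lambda>x. trunc k x - f x"] by (simp add: dist)
  qed
  have "(\<lambda>k. \<bar>(\<integral>x. g x \<partial>\<mu>) * (\<integral>x. trunc k x \<partial>\<mu>) - L\<bar>)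
      \<longlonglongrightarrow> \<bar>(\<integral>x. g x \<partial>\<mu>) * (\<integral>x. f x \<partial>\<mu>) - L\<bar>"
    by (intro tendsto_intros lim)
  moreover have "(\<lambda>k. e + C * \<delta> k) \<longlonglongrightarrow> e + C * 0"
    by (intro tendsto_intros \<delta>)
  ultimately show ?thesis
    using near_k by (auto intro: LIMSEQ_le)
qed

end

section \<open>The dual process\<close>

lemma space_config_space: "space (config_space E) = {\<eta>. \<forall>x. \<eta> x \<in> E}"
  by (auto simp: config_space_def space_PiM space_restrict_space PiE_def Pi_def)

text \<open>A finite configuration is coded by its graph over the support, a finite set of pairs.
  Countability makes \<open>D (\<omega> t) \<eta>\<close> jointly measurable in
  \<open>duality_against_initial\<close>.\<close>

lemma countable_finite_configs: "countable (finite_configs E' :: ('v::countable \<Rightarrow> nat) set)"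
proof -
  let ?graph = "\<lambda>\<xi> :: 'v \<Rightarrow> nat. (\<lambda>x. (x, \<xi> x)) ` {x. \<xi> x \<noteq> 0}"
  have "inj_on ?graph (finite_configs E')"
  proof (rule inj_onI, rule ext)
    fix \<xi> \<zeta> :: "'v \<Rightarrow> nat" and x assume eq: "?graph \<xi> = ?graph \<zeta>"
    have "(x, k) \<in> ?graph \<xi> \<longleftrightarrow> k = \<xi> x \<and> k \<noteq> 0" "(x, k) \<in> ?graph \<zeta> \<longleftrightarrow> k = \<zeta> x \<and> k \<noteq> 0" for k
      by auto
    then show "\<xi> x = \<zeta> x" unfolding eq by metis
  qed
  moreover have "countable (?graph ` finite_configs E')"
    by (rule countable_subset[OF _ countable_Collect_finite]) (auto simp: finite_configs_def)
  ultimately show ?thesis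
    by (rule countable_image_inj_on[rotated])
qed

lemma mass_superset: "finite A \<Longrightarrow> {x. \<xi> x \<noteq> 0} \<subseteq> A \<Longrightarrow> mass \<xi> = (\<Sum>x\<in>A. \<xi> x)"
  unfolding mass_def by (rule sum.mono_neutral_left) auto

lemma mass_delta_config: "mass (delta_config x) = 1"
  by (subst mass_superset[of "{x}"]) (auto simp: delta_config_def)

text \<open>Identifies the one-particle configurations with the sites, so that the dual started from
  one particle is a random walk.\<close>

lemma mass_eq_1_iff: "mass \<xi> = 1 \<longleftrightarrow> (\<exists>x. \<xi> = delta_config x)"
proof
  assume *: "mass \<xi> = 1"
  \<comment> \<open>A configuration of infinite support has \<open>mass\<close> 0, the default value
    of an infinite sum.\<close>
  have fin: "finite {x. \<xi> x \<noteq> 0}"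
  proof (rule ccontr)
    assume "infinite {x. \<xi> x \<noteq> 0}"
    then have "mass \<xi> = 0" unfolding mass_def by (rule sum.infinite)
    with * show False by simp
  qed
  from * obtain x where x: "\<xi> x = 1" and others: "\<forall>y\<in>{x. \<xi> x \<noteq> 0}. x \<noteq> y \<longrightarrow> \<xi> y = 0"
    unfolding mass_def sum_eq_1_iff[OF fin] by blast
  have "\<xi> y = 0" if "y \<noteq> x" for y
  proof (rule ccontr)
    assume "\<xi> y \<noteq> 0"
    with others that have "\<xi> y = 0" by simp
    with \<open>\<xi> y \<noteq> 0\<close> show False ..
  qed
  with x have "\<xi> = delta_config x"
    by (simp add: delta_config_def fun_eq_iff)
  then show "\<exists>x. \<xi> = delta_config x" ..
qed (auto simp: mass_delta_config)

lemma mass_fun_upd: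
  assumes "finite {x. \<xi> x \<noteq> 0}" "\<xi> z = 0"
  shows "mass (\<xi>(z := k)) = mass \<xi> + k"
proof -
  have "mass (\<xi>(z := k)) = (\<Sum>x\<in>insert z {x. \<xi> x \<noteq> 0}. (\<xi>(z := k)) x)"
    by (rule mass_superset) (use assms in auto)
  also have "\<dots> = k + (\<Sum>x | \<xi> x \<noteq> 0. \<xi> x)"
    using assms by (subst sum.insert) (auto intro!: sum.cong)
  finally show ?thesis by (simp add: mass_def)
qed

text \<open>The lattice enters through countability of the sites, here, and through their
  infinitude, in \<open>moment_eq_power\<close>. The values 0 and 1 in \<open>E'\<close> provide the
  empty and the one-particle configurations.\<close>

locale dual_process = stationary_markov "config_space E" P \<mu>
  for E and P :: "('v::countable \<Rightarrow> real) \<Rightarrow> (real \<Rightarrow> 'v \<Rightarrow> real) measure" and \<mu> +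
  fixes E' :: "nat set" and d :: "nat \<Rightarrow> real \<Rightarrow> real"
    and Q :: "('v \<Rightarrow> nat) \<Rightarrow> (real \<Rightarrow> 'v \<Rightarrow> nat) measure"
  assumes dual_markov: "markov_process (count_space (finite_configs E')) Q"
    and zero_one_E': "0 \<in> E'" "1 \<in> E'"
    and d_0: "\<forall>a\<in>E. d 0 a = 1"
    and duality: "dual_processes (config_space E) P (finite_configs E') Q (factorized d)"
    and conservation: "conserves_particles (finite_configs E') Q"
    and domination: "uniformly_dominated (finite_configs E') (factorized d) \<mu>"
begin

abbreviation F :: "('v \<Rightarrow> nat) set" where "F \<equiv> finite_configs E'"

abbreviation D :: "('v \<Rightarrow> nat) \<Rightarrow> ('v \<Rightarrow> real) \<Rightarrow> real" where "D \<equiv> factorized d"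

definition moment :: "('v \<Rightarrow> nat) \<Rightarrow> real" where
  "moment \<xi> = (\<integral>\<eta>. D \<xi> \<eta> \<partial>\<mu>)"

lemma finite_support: "\<xi> \<in> F \<Longrightarrow> finite {x. \<xi> x \<noteq> 0}"
  by (simp add: finite_configs_def)

lemma fun_upd_in_F: "\<xi> \<in> F \<Longrightarrow> k \<in> E' \<Longrightarrow> \<xi>(z := k) \<in> F"
  by (auto simp: finite_configs_def intro: rev_finite_subset[of "insert z {x. \<xi> x \<noteq> 0}"])

lemma zero_in_F: "(\<lambda>_. 0) \<in> F"
  using zero_one_E' by (simp add: finite_configs_def)

lemma delta_config_eq: "delta_config x = (\<lambda>_. 0)(x := 1)"
  by (simp add: delta_config_def fun_eq_iff)

lemma delta_config_in_F: "delta_config x \<in> F"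
  unfolding delta_config_eq using fun_upd_in_F[OF zero_in_F] zero_one_E' by simp

text \<open>The identity \<open>d 0 a = 1\<close> is known for \<open>a \<in> E\<close> only, hence
  the restriction to states in \<open>space \<mu>\<close>.\<close>

lemma factorized_eq_prod:
  assumes "\<eta> \<in> space \<mu>" "finite A" "{x. \<xi> x \<noteq> 0} \<subseteq> A"
  shows "D \<xi> \<eta> = (\<Prod>x\<in>A. d (\<xi> x) (\<eta> x))"
  unfolding factorized_def
proof (rule Prod_any.expand_superset)
  have one: "d 0 (\<eta> x) = 1" for x
    using assms(1) d_0 by (simp add: space_initial space_config_space)
  show "{x. d (\<xi> x) (\<eta> x) \<noteq> 1} \<subseteq> A"
  proof
    fix x assume "x \<in> {x. d (\<xi> x) (\<eta> x) \<noteq> 1}"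
    then have "\<xi> x \<noteq> 0" using one[of x] by (intro notI) simp
    then show "x \<in> A" using assms(3) by blast
  qed
qed fact

lemma factorized_single:
  assumes "\<eta> \<in> space \<mu>"
  shows "D ((\<lambda>_. 0)(x := k)) \<eta> = d k (\<eta> x)"
  by (subst factorized_eq_prod[OF assms, of "{x}"]) auto

lemma factorized_delta_config: "\<eta> \<in> space \<mu> \<Longrightarrow> D (delta_config x) \<eta> = d 1 (\<eta> x)"
  unfolding delta_config_eq by (rule factorized_single)

text \<open>The site must be empty: at an occupied one the product contains
  \<open>d (\<xi> z) (\<eta> z) * d 1 (\<eta> z)\<close>, in general not a value of \<open>d\<close>
  at any particle number.\<close>

lemma factorized_fun_upd:
  assumes "\<eta> \<in> space \<mu>" "\<xi> \<in> F" "\<xi> z = 0"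
  shows "D (\<xi>(z := 1)) \<eta> = D \<xi> \<eta> * D (delta_config z) \<eta>"
proof -
  let ?A = "{x. \<xi> x \<noteq> 0}"
  have A: "finite ?A" "z \<notin> ?A" using assms finite_support by auto
  have "D (\<xi>(z := 1)) \<eta> = (\<Prod>x\<in>insert z ?A. d ((\<xi>(z := 1)) x) (\<eta> x))"
    using A by (intro factorized_eq_prod[OF assms(1)]) auto
  also have "\<dots> = d 1 (\<eta> z) * (\<Prod>x\<in>?A. d (\<xi> x) (\<eta> x))"
    using A by (subst prod.insert) (auto intro!: prod.cong)
  also have "\<dots> = D (delta_config z) \<eta> * D \<xi> \<eta>"
    using factorized_eq_prod[OF assms(1) A(1) subset_refl] by (simp add: factorized_delta_config[OF assms(1)])
  finally show ?thesis by simp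
qed

lemma dominating_function:
  obtains f where "integrable \<mu> f"
    "\<And>\<eta> \<xi>. \<eta> \<in> space \<mu> \<Longrightarrow> \<xi> \<in> F \<Longrightarrow> mass \<xi> = n \<Longrightarrow> \<bar>D \<xi> \<eta>\<bar> \<le> f \<eta>"
  using domination unfolding uniformly_dominated_def by metis

lemma D_measurable: "\<xi> \<in> F \<Longrightarrow> D \<xi> \<in> borel_measurable (config_space E)"
  using duality by (simp add: dual_processes_def)

lemma D_integrable:
  assumes "\<xi> \<in> F"
  shows "integrable \<mu> (D \<xi>)"
proof -
  obtain f where f: "integrable \<mu> f"
    "\<And>\<eta> \<zeta>. \<eta> \<in> space \<mu> \<Longrightarrow> \<zeta> \<in> F \<Longrightarrow> mass \<zeta> = mass \<xi> \<Longrightarrow> \<bar>D \<zeta> \<eta>\<bar> \<le> f \<eta>"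
    using dominating_function[of "mass \<xi>"] by blast
  show ?thesis
  proof (rule Bochner_Integration.integrable_bound[OF f(1)])
    show "D \<xi> \<in> borel_measurable \<mu>"
      using D_measurable[OF assms] by (simp add: measurable_cong_sets[OF sets_initial refl])
    show "AE \<eta> in \<mu>. norm (D \<xi> \<eta>) \<le> norm (f \<eta>)"
    proof (rule AE_I2)
      fix \<eta> assume "\<eta> \<in> space \<mu>"
      from f(2)[OF this assms refl] show "norm (D \<xi> \<eta>) \<le> norm (f \<eta>)" by simp
    qed
  qed
qed

section \<open>Duality under the stationary law\<close>

lemma
  assumes "\<xi> \<in> F"
  shows prob_space_dual: "prob_space (Q \<xi>)"
    and sets_dual: "sets (Q \<xi>) = sets (path_space (count_space F))"
proof -
  have "Q \<in> count_space F \<rightarrow>\<^sub>M prob_algebra (path_space (count_space F))"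
    using dual_markov unfolding markov_process_def by (elim conjE)
  from measurable_space[OF this, of \<xi>] assms
  have "Q \<xi> \<in> space (prob_algebra (path_space (count_space F)))"
    by simp
  then show "prob_space (Q \<xi>)" "sets (Q \<xi>) = sets (path_space (count_space F))"
    by (simp_all add: space_prob_algebra)
qed

lemma dual_component_measurable:
  assumes "\<xi> \<in> F" "0 \<le> t"
  shows "(\<lambda>\<omega>. \<omega> t) \<in> Q \<xi> \<rightarrow>\<^sub>M count_space F"
  using measurable_path_component[OF assms(2)]
  by (simp add: measurable_cong_sets[OF sets_dual[OF assms(1)] refl])

lemma dual_component_borel:
  fixes h :: "('v \<Rightarrow> nat) \<Rightarrow> real"
  assumes "\<xi> \<in> F" "0 \<le> t"
  shows "(\<lambda>\<omega>. h (\<omega> t)) \<in> borel_measurable (Q \<xi>)"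
  using measurable_compose[OF dual_component_measurable[OF assms], of h borel] by simp

lemma dual_component_in_F: "\<xi> \<in> F \<Longrightarrow> 0 \<le> t \<Longrightarrow> \<omega> \<in> space (Q \<xi>) \<Longrightarrow> \<omega> t \<in> F"
  using measurable_space[OF dual_component_measurable] by simp

lemma AE_dual_mass:
  assumes "\<xi> \<in> F" "0 \<le> t"
  shows "AE \<omega> in Q \<xi>. \<omega> t \<in> F \<and> mass (\<omega> t) = mass \<xi>"
proof -
  have "AE \<omega> in Q \<xi>. mass (\<omega> t) = mass \<xi>"
    using conservation assms by (simp add: conserves_particles_def)
  then show ?thesis
    using AE_space by eventually_elim (simp add: dual_component_in_F[OF assms])
qed

text \<open>Duality at a fixed initial state, integrated over \<open>\<mu>\<close>, followed by
  Fubini. The dual reaches many configurations, but conservation keeps them at the mass of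
  \<open>\<xi>\<close>, where uniform domination provides the single integrable bound
  \<open>C * f\<close>.\<close>

lemma duality_against_initial:
  assumes t: "0 < t" and \<xi>: "\<xi> \<in> F"
    and g: "g \<in> borel_measurable (config_space E)" "\<And>\<eta>. \<eta> \<in> space (config_space E) \<Longrightarrow> \<bar>g \<eta>\<bar> \<le> C"
  shows "(\<integral>\<omega>. g (\<omega> 0) * D \<xi> (\<omega> t) \<partial>law) = (\<integral>\<omega>. (\<integral>\<eta>. g \<eta> * D (\<omega> t) \<eta> \<partial>\<mu>) \<partial>Q \<xi>)"
proof -
  interpret dual: prob_space "Q \<xi>" by (rule prob_space_dual[OF \<xi>])
  interpret pair: pair_sigma_finite \<mu> "Q \<xi>" ..
  have t0: "0 \<le> t" using t by simp
  have g': "g \<in> borel_measurable \<mu>"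
    using g(1) by (simp add: measurable_cong_sets[OF sets_initial refl])
  obtain f where f: "integrable \<mu> f"
    and f_bound: "\<And>\<eta> \<zeta>. \<eta> \<in> space \<mu> \<Longrightarrow> \<zeta> \<in> F \<Longrightarrow> mass \<zeta> = mass \<xi> \<Longrightarrow> \<bar>D \<zeta> \<eta>\<bar> \<le> f \<eta>"
    using dominating_function[of "mass \<xi>"] by blast
  \<comment> \<open>The random index \<open>\<omega> t\<close> ranges over the countable set
    \<open>F\<close>, so measurability of each \<open>D \<zeta>\<close> in the state is
    enough.\<close>
  have joint: "(\<lambda>p. D (snd p t) (fst p)) \<in> borel_measurable (\<mu> \<Otimes>\<^sub>M Q \<xi>)"
  proof (rule measurable_compose_countable'[where I = F and f = "\<lambda>\<zeta> p. D \<zeta> (fst p)" and g = "\<lambda>p. snd p t"])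
    show "(\<lambda>p. D \<zeta> (fst p)) \<in> borel_measurable (\<mu> \<Otimes>\<^sub>M Q \<xi>)" if "\<zeta> \<in> F" for \<zeta>
      using measurable_compose[OF measurable_fst, of "D \<zeta>" \<mu> borel] D_integrable[OF that] by simp
    show "(\<lambda>p. snd p t) \<in> \<mu> \<Otimes>\<^sub>M Q \<xi> \<rightarrow>\<^sub>M count_space F"
      using measurable_compose[OF measurable_snd dual_component_measurable[OF \<xi> t0]] .
  qed (rule countable_finite_configs)
  have joint_g: "(\<lambda>p. g (fst p) * D (snd p t) (fst p)) \<in> borel_measurable (\<mu> \<Otimes>\<^sub>M Q \<xi>)"
    using measurable_compose[OF measurable_fst g'] joint by measurable
  have bound: "AE \<omega> in Q \<xi>. \<bar>g \<eta> * D (\<omega> t) \<eta>\<bar> \<le> C * f \<eta>" if \<eta>: "\<eta> \<in> space \<mu>" for \<eta>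
    using AE_dual_mass[OF \<xi> t0]
  proof eventually_elim
    case (elim \<omega>)
    then show ?case
      using f_bound[OF \<eta>] g(2)[of \<eta>] \<eta>
      by (auto simp: abs_mult space_initial intro!: mult_mono order_trans[OF abs_ge_zero])
  qed
  have inner: "integrable (Q \<xi>) (\<lambda>\<omega>. g \<eta> * D (\<omega> t) \<eta>)" if \<eta>: "\<eta> \<in> space \<mu>" for \<eta>
    using bound[OF \<eta>] by (intro dual.integrable_const_bound[where B = "C * f \<eta>"])
      (auto intro!: borel_measurable_times dual_component_borel[OF \<xi> t0, of "\<lambda>\<zeta>. D \<zeta> \<eta>"])
  have int: "integrable (\<mu> \<Otimes>\<^sub>M Q \<xi>) (\<lambda>p. g (fst p) * D (snd p t) (fst p))"
  proof (rule pair.Fubini_integrable[OF joint_g])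
    show "AE \<eta> in \<mu>. integrable (Q \<xi>) (\<lambda>\<omega>. g (fst (\<eta>, \<omega>)) * D (snd (\<eta>, \<omega>) t) (fst (\<eta>, \<omega>)))"
      using inner by (intro AE_I2) simp
    show "integrable \<mu> (\<lambda>\<eta>. \<integral>\<omega>. norm (g (fst (\<eta>, \<omega>)) * D (snd (\<eta>, \<omega>) t) (fst (\<eta>, \<omega>))) \<partial>Q \<xi>)"
    proof (rule Bochner_Integration.integrable_bound)
      show "integrable \<mu> (\<lambda>\<eta>. C * f \<eta>)" using f by simp
      show "(\<lambda>\<eta>. \<integral>\<omega>. norm (g (fst (\<eta>, \<omega>)) * D (snd (\<eta>, \<omega>) t) (fst (\<eta>, \<omega>))) \<partial>Q \<xi>) \<in> borel_measurable \<mu>"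
        by (rule dual.borel_measurable_lebesgue_integral) (use joint_g in \<open>simp add: split_beta'\<close>)
      show "AE \<eta> in \<mu>. norm (\<integral>\<omega>. norm (g (fst (\<eta>, \<omega>)) * D (snd (\<eta>, \<omega>) t) (fst (\<eta>, \<omega>))) \<partial>Q \<xi>) \<le> norm (C * f \<eta>)"
      proof (rule AE_I2)
        fix \<eta> assume \<eta>: "\<eta> \<in> space \<mu>"
        have "(\<integral>\<omega>. norm (g \<eta> * D (\<omega> t) \<eta>) \<partial>Q \<xi>) \<le> (\<integral>\<omega>. C * f \<eta> \<partial>Q \<xi>)"
          using bound[OF \<eta>] inner[OF \<eta>] by (intro integral_mono_AE) auto
        then show "norm (\<integral>\<omega>. norm (g (fst (\<eta>, \<omega>)) * D (snd (\<eta>, \<omega>) t) (fst (\<eta>, \<omega>))) \<partial>Q \<xi>) \<le> norm (C * f \<eta>)"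
          by (simp add: dual.prob_space)
      qed
    qed
  qed
  have "(\<integral>\<omega>. g (\<omega> 0) * D \<xi> (\<omega> t) \<partial>law) = (\<integral>\<eta>. g \<eta> * (\<integral>\<omega>. D \<xi> (\<omega> t) \<partial>P \<eta>) \<partial>\<mu>)"
    by (rule integral_law_initial_mult(2)[OF t0 g D_integrable[OF \<xi>]])
  also have "\<dots> = (\<integral>\<eta>. (\<integral>\<omega>. g \<eta> * D (\<omega> t) \<eta> \<partial>Q \<xi>) \<partial>\<mu>)"
    using duality t \<xi> by (intro Bochner_Integration.integral_cong refl) (simp add: dual_processes_def space_initial)
  also have "\<dots> = (\<integral>\<omega>. (\<integral>\<eta>. g \<eta> * D (\<omega> t) \<eta> \<partial>\<mu>) \<partial>Q \<xi>)"
    using pair.Fubini_integral[of "\<lambda>\<eta> \<omega>. g \<eta> * D (\<omega> t) \<eta>"] int by (simp add: split_beta')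
  finally show ?thesis .
qed

text \<open>With \<open>g = 1\<close> the correlation is the mean of \<open>D \<xi>\<close> at time
  \<open>t\<close>, which stationarity returns to time 0.\<close>

lemma moment_harmonic:
  assumes "0 < t" "\<xi> \<in> F"
  shows "(\<integral>\<omega>. moment (\<omega> t) \<partial>Q \<xi>) = moment \<xi>"
proof -
  have "(\<integral>\<omega>. moment (\<omega> t) \<partial>Q \<xi>) = (\<integral>\<omega>. D \<xi> (\<omega> t) \<partial>law)"
    using duality_against_initial[OF assms, of "\<lambda>_. 1" 1] by (simp add: moment_def)
  also have "\<dots> = moment \<xi>"
    unfolding moment_def using assms by (intro integral_law_component D_integrable) simp_all
  finally show ?thesis .
qed

lemma moment_eq_of_mass_eq:
  assumes harmonic: "bounded_harmonic_triviality F Q"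
    and \<xi>: "\<xi> \<in> F" "\<zeta> \<in> F" "mass \<xi> = mass \<zeta>"
  shows "moment \<xi> = moment \<zeta>"
proof -
  text \<open>The moments are bounded only on each level set of the mass, hence the truncation.\<close>
  define H where "H \<theta> = (if mass \<theta> = mass \<xi> then moment \<theta> else 0)" for \<theta>
  obtain f where f: "integrable \<mu> f"
    and f_bound: "\<And>\<eta> \<theta>. \<eta> \<in> space \<mu> \<Longrightarrow> \<theta> \<in> F \<Longrightarrow> mass \<theta> = mass \<xi> \<Longrightarrow> \<bar>D \<theta> \<eta>\<bar> \<le> f \<eta>"
    using dominating_function[of "mass \<xi>"] by blast
  have "\<bar>H \<theta>\<bar> \<le> \<bar>\<integral>\<eta>. f \<eta> \<partial>\<mu>\<bar>" if \<theta>: "\<theta> \<in> F" for \<theta>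
  proof (cases "mass \<theta> = mass \<xi>")
    case True
    have "\<bar>moment \<theta>\<bar> \<le> (\<integral>\<eta>. \<bar>D \<theta> \<eta>\<bar> \<partial>\<mu>)"
      unfolding moment_def by simp
    also have "\<dots> \<le> (\<integral>\<eta>. f \<eta> \<partial>\<mu>)"
      using f D_integrable[OF \<theta>] f_bound[OF _ \<theta> True] by (intro integral_mono) auto
    finally show ?thesis using True by (simp add: H_def)
  qed (simp add: H_def)
  then have "bounded (H ` F)"
    by (auto simp: bounded_iff)
  moreover have "(\<integral>\<omega>. H (\<omega> t) \<partial>Q \<theta>) = H \<theta>" if "0 < t" "\<theta> \<in> F" for t \<theta>
  proof -
    have t: "0 \<le> t" using that by simp
    \<comment> \<open>Conservation freezes the condition in \<open>H\<close>: along the dual path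
      the mass stays that of \<open>\<theta>\<close>, so the truncation commutes with the
      expectation.\<close>
    have "(\<integral>\<omega>. H (\<omega> t) \<partial>Q \<theta>) = (\<integral>\<omega>. (if mass \<theta> = mass \<xi> then moment (\<omega> t) else 0) \<partial>Q \<theta>)"
    proof (rule integral_cong_AE)
      show "AE \<omega> in Q \<theta>. H (\<omega> t) = (if mass \<theta> = mass \<xi> then moment (\<omega> t) else 0)"
        using AE_dual_mass[OF that(2) t] by eventually_elim (simp add: H_def)
    qed (intro dual_component_borel[OF that(2) t] dual_component_borel[OF that(2) t, of "\<lambda>\<zeta>. if _ then moment \<zeta> else 0"])+
    then show ?thesis
      using moment_harmonic[OF that] by (simp add: H_def)
  qed
  ultimately have "\<exists>\<psi> :: nat \<Rightarrow> real. bounded (range \<psi>) \<and> (\<forall>\<xi>\<in>F. H \<xi> = \<psi> (mass \<xi>))"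
    using harmonic unfolding bounded_harmonic_triviality_def by blast
  then have "H \<xi> = H \<zeta>" using \<xi> by metis
  then show ?thesis using \<xi> by (simp add: H_def)
qed

section \<open>Adding a particle\<close>

text \<open>Splits according to whether the particle sits in \<open>A\<close>. The crude bound
  \<open>B\<close> is weighted by the probability of a finite set, which vanishes for large times,
  so the values off \<open>A\<close> decide.\<close>

lemma one_particle_expectation_near:
  assumes t: "0 \<le> t" and A: "finite A" and B: "0 \<le> B" and e: "0 \<le> e"
    and in_A: "\<And>y. y \<in> A \<Longrightarrow> \<bar>\<Phi> (delta_config y) - L\<bar> \<le> B"
    and off_A: "\<And>y. y \<notin> A \<Longrightarrow> \<bar>\<Phi> (delta_config y) - L\<bar> \<le> e"
  shows "\<bar>(\<integral>\<omega>. \<Phi> (\<omega> t) \<partial>Q (delta_config x)) - L\<bar> \<le> e + B * (\<Sum>y\<in>A. one_particle_prob Q t x y)"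
proof -
  let ?Q = "Q (delta_config x)"
  interpret dual: prob_space ?Q by (rule prob_space_dual[OF delta_config_in_F])
  define hit where "hit y = {\<omega> \<in> space ?Q. \<omega> t = delta_config y}" for y
  have hit: "hit y \<in> sets ?Q" for y
  proof -
    have "(\<lambda>\<omega>. \<omega> t) -` {delta_config y} \<inter> space ?Q \<in> sets ?Q"
      using dual_component_measurable[OF delta_config_in_F t] by (rule measurable_sets) (simp add: delta_config_in_F)
    also have "(\<lambda>\<omega>. \<omega> t) -` {delta_config y} \<inter> space ?Q = hit y"
      by (auto simp: hit_def)
    finally show ?thesis .
  qed
  have bound: "AE \<omega> in ?Q. \<bar>\<Phi> (\<omega> t) - L\<bar> \<le> e + B * (\<Sum>y\<in>A. indicator (hit y) \<omega>)"
    using AE_dual_mass[OF delta_config_in_F t, of x] AE_space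
  proof eventually_elim
    case (elim \<omega>)
    then obtain y where y: "\<omega> t = delta_config y"
      using mass_eq_1_iff mass_delta_config by metis
    have nonneg: "(0 :: real) \<le> indicator (hit z) \<omega>" for z by simp
    show ?case
    proof (cases "y \<in> A")
      case True
      have "(1 :: real) = indicator (hit y) \<omega>"
        using y elim by (simp add: hit_def)
      also have "\<dots> \<le> (\<Sum>y\<in>A. indicator (hit y) \<omega>)"
        by (rule member_le_sum[OF True]) (use A nonneg in auto)
      finally have "B * 1 \<le> B * (\<Sum>y\<in>A. indicator (hit y) \<omega>)"
        using B by (rule mult_left_mono)
      then show ?thesis using in_A[OF True] e y by simp
    next
      case False
      have "0 \<le> B * (\<Sum>y\<in>A. indicator (hit y) \<omega>)"
        using B nonneg by (intro mult_nonneg_nonneg sum_nonneg) auto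
      then show ?thesis using off_A[OF False] y by simp
    qed
  qed
  have hit_int: "integrable ?Q (indicator (hit y) :: _ \<Rightarrow> real)" for y
    using hit by (intro integrable_real_indicator) (auto simp: dual.emeasure_eq_measure)
  have sum_int: "integrable ?Q (\<lambda>\<omega>. e + B * (\<Sum>y\<in>A. indicator (hit y) \<omega>))"
    using hit_int by simp
  have meas: "(\<lambda>\<omega>. \<Phi> (\<omega> t)) \<in> borel_measurable ?Q"
    by (rule dual_component_borel[OF delta_config_in_F t])
  have int: "integrable ?Q (\<lambda>\<omega>. \<Phi> (\<omega> t) - L)"
  proof (rule Bochner_Integration.integrable_bound[OF sum_int])
    show "(\<lambda>\<omega>. \<Phi> (\<omega> t) - L) \<in> borel_measurable ?Q"
      using meas by measurable
    show "AE \<omega> in ?Q. norm (\<Phi> (\<omega> t) - L) \<le> norm (e + B * (\<Sum>y\<in>A. indicator (hit y) \<omega>))"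
      using bound by eventually_elim simp
  qed
  have int\<Phi>: "integrable ?Q (\<lambda>\<omega>. \<Phi> (\<omega> t))"
    using Bochner_Integration.integrable_add[OF int dual.integrable_const[of L]] by simp
  have "(\<integral>\<omega>. \<Phi> (\<omega> t) \<partial>?Q) - L = (\<integral>\<omega>. \<Phi> (\<omega> t) - L \<partial>?Q)"
    using int\<Phi> by (simp add: dual.prob_space)
  also have "\<bar>\<dots>\<bar> \<le> (\<integral>\<omega>. \<bar>\<Phi> (\<omega> t) - L\<bar> \<partial>?Q)"
    by simp
  also have "\<dots> \<le> (\<integral>\<omega>. e + B * (\<Sum>y\<in>A. indicator (hit y) \<omega>) \<partial>?Q)"
    using int sum_int bound by (intro integral_mono_AE) auto
  also have "\<dots> = e + B * (\<Sum>y\<in>A. measure ?Q (hit y))"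
    using hit_int hit by (simp add: dual.prob_space)
  finally show ?thesis
    by (simp add: hit_def one_particle_prob_def)
qed

text \<open>The target \<open>?L\<close> is the moment with one more particle at any empty site,
  since moments depend on the mass only. The dual walk from \<open>z\<close> is eventually at such a
  site with high probability, so correlations at large times are near \<open>?L\<close>;
  \<open>decorrelation\<close> equates them with a product of means.\<close>

lemma moment_fun_upd:
  assumes erg: "time_ergodic (config_space E) P \<mu>"
    and harmonic: "bounded_harmonic_triviality F Q"
    and spreading: "\<And>x y. ((\<lambda>t. one_particle_prob Q t x y) \<longlongrightarrow> 0) at_top"
    and \<xi>: "\<xi> \<in> F" "\<xi> z = 0"
  shows "moment (\<xi>(z := 1)) = moment \<xi> * moment (delta_config z)"
proof -
  let ?L = "moment (\<xi>(z := 1))" and ?A = "{x. \<xi> x \<noteq> 0}"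
  have A: "finite ?A" by (rule finite_support[OF \<xi>(1)])
  have upd_F: "\<xi>(y := 1) \<in> F" for y
    using fun_upd_in_F[OF \<xi>(1) zero_one_E'(2)] .
  obtain f where f: "integrable \<mu> f"
    and f_bound: "\<And>\<eta> \<zeta>. \<eta> \<in> space \<mu> \<Longrightarrow> \<zeta> \<in> F \<Longrightarrow> mass \<zeta> = mass \<xi> \<Longrightarrow> \<bar>D \<zeta> \<eta>\<bar> \<le> f \<eta>"
    using dominating_function[of "mass \<xi>"] by blast
  obtain f1 where f1: "integrable \<mu> f1"
    and f1_bound: "\<And>\<eta> \<zeta>. \<eta> \<in> space \<mu> \<Longrightarrow> \<zeta> \<in> F \<Longrightarrow> mass \<zeta> = 1 \<Longrightarrow> \<bar>D \<zeta> \<eta>\<bar> \<le> f1 \<eta>"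
    using dominating_function[of 1] by blast
  obtain f2 where f2: "integrable \<mu> f2"
    and f2_bound: "\<And>\<eta> \<zeta>. \<eta> \<in> space \<mu> \<Longrightarrow> \<zeta> \<in> F \<Longrightarrow> mass \<zeta> = mass \<xi> + 1 \<Longrightarrow> \<bar>D \<zeta> \<eta>\<bar> \<le> f2 \<eta>"
    using dominating_function[of "mass \<xi> + 1"] by blast
  have f_meas: "f \<in> borel_measurable \<mu>" using f by simp
  text \<open>Products of duality functions at a common site need not be integrable, so \<open>D \<xi>\<close> is
    truncated; the walk started from \<open>z\<close> leaves the support of \<open>\<xi>\<close>, where this matters.\<close>
  define g where "g k \<eta> = (if f \<eta> \<le> real k then D \<xi> \<eta> else 0)" for k \<eta>
  \<comment> \<open>\<open>f2\<close> dominates all configurations with one particle more than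
    \<open>\<xi>\<close>, so this tail bounds the truncation error for every empty site
    \<open>y\<close> at once.\<close>
  define \<epsilon> where "\<epsilon> k = (\<integral>\<eta>. \<bar>f2 \<eta>\<bar> * indicator {\<eta>. real k < f \<eta>} \<eta> \<partial>\<mu>)" for k
  define \<delta> where "\<delta> k = (\<integral>\<eta>. \<bar>f \<eta>\<bar> * indicator {\<eta>. real k < f \<eta>} \<eta> \<partial>\<mu>)" for k
  have \<epsilon>: "\<epsilon> \<longlonglongrightarrow> 0" and \<delta>: "\<delta> \<longlonglongrightarrow> 0"
    unfolding \<epsilon>_def \<delta>_def using f f2 by (auto intro!: tendsto_truncation_L1)
  have indicator_int: "integrable \<mu> (\<lambda>\<eta>. \<bar>h \<eta>\<bar> * indicator {\<eta>. real k < f \<eta>} \<eta>)"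
    if h: "integrable \<mu> h" for h :: "('v \<Rightarrow> real) \<Rightarrow> real" and k
  proof -
    have "integrable \<mu> (\<lambda>\<eta>. \<bar>h \<eta>\<bar> * indicator {\<eta> \<in> space \<mu>. real k < f \<eta>} \<eta>)"
      using h f_meas by (intro integrable_real_mult_indicator) auto
    then show ?thesis
      by (rule Bochner_Integration.integrable_cong[OF refl, THEN iffD1, rotated]) (simp split: split_indicator)
  qed
  have g_meas: "g k \<in> borel_measurable \<mu>" for k
    unfolding g_def using f_meas D_integrable[OF \<xi>(1)] by measurable
  have g_bound: "\<bar>g k \<eta>\<bar> \<le> real k" if "\<eta> \<in> space \<mu>" for k \<eta>
    using f_bound[OF that \<xi>(1) refl] by (simp add: g_def)
  have g_int: "integrable \<mu> (\<lambda>\<eta>. g k \<eta> * h \<eta>)" if h: "integrable \<mu> h" for h k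
  proof (rule Bochner_Integration.integrable_bound)
    show "integrable \<mu> (\<lambda>\<eta>. real k * h \<eta>)" using h by simp
    show "(\<lambda>\<eta>. g k \<eta> * h \<eta>) \<in> borel_measurable \<mu>" using h g_meas by simp
    show "AE \<eta> in \<mu>. norm (g k \<eta> * h \<eta>) \<le> norm (real k * h \<eta>)"
      using g_bound by (intro AE_I2) (simp add: abs_mult mult_right_mono)
  qed
  have off: "\<bar>(\<integral>\<eta>. g k \<eta> * D (delta_config y) \<eta> \<partial>\<mu>) - ?L\<bar> \<le> \<epsilon> k" if y: "y \<notin> ?A" for k y
  proof -
    have y0: "\<xi> y = 0" using y by simp
    have mass_upd: "mass (\<xi>(y := 1)) = mass \<xi> + 1"
      by (rule mass_fun_upd[OF A y0])
    have "mass (\<xi>(y := 1)) = mass (\<xi>(z := 1))"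
      using mass_upd mass_fun_upd[OF A \<xi>(2), of 1] by simp
    then have L: "?L = (\<integral>\<eta>. D (\<xi>(y := 1)) \<eta> \<partial>\<mu>)"
      using moment_eq_of_mass_eq[OF harmonic upd_F upd_F, of z y] by (simp only: moment_def)
    have "(\<integral>\<eta>. g k \<eta> * D (delta_config y) \<eta> \<partial>\<mu>) - ?L
        = (\<integral>\<eta>. g k \<eta> * D (delta_config y) \<eta> - D (\<xi>(y := 1)) \<eta> \<partial>\<mu>)"
      unfolding L
      using g_int[OF D_integrable[OF delta_config_in_F]] D_integrable[OF upd_F]
      by (intro Bochner_Integration.integral_diff[symmetric])
    also have "\<bar>\<dots>\<bar> \<le> (\<integral>\<eta>. \<bar>g k \<eta> * D (delta_config y) \<eta> - D (\<xi>(y := 1)) \<eta>\<bar> \<partial>\<mu>)"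
      by simp
    also have "\<dots> \<le> \<epsilon> k"
      unfolding \<epsilon>_def
    proof (rule integral_mono)
      show "integrable \<mu> (\<lambda>\<eta>. \<bar>g k \<eta> * D (delta_config y) \<eta> - D (\<xi>(y := 1)) \<eta>\<bar>)"
        using g_int[OF D_integrable[OF delta_config_in_F]] D_integrable[OF upd_F]
        by (intro integrable_abs Bochner_Integration.integrable_diff)
      fix \<eta> assume \<eta>: "\<eta> \<in> space \<mu>"
      \<comment> \<open>Below the cutoff the factorization is exact; above it \<open>g k\<close>
        vanishes and only the tail of the new configuration is left.\<close>
      show "\<bar>g k \<eta> * D (delta_config y) \<eta> - D (\<xi>(y := 1)) \<eta>\<bar> \<le> \<bar>f2 \<eta>\<bar> * indicator {\<eta>. real k < f \<eta>} \<eta>"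
      proof (cases "f \<eta> \<le> real k")
        case True
        then show ?thesis
          unfolding factorized_fun_upd[OF \<eta> \<xi>(1) y0] by (simp add: g_def)
      next
        case False
        have "\<bar>D (\<xi>(y := 1)) \<eta>\<bar> \<le> f2 \<eta>"
          by (rule f2_bound[OF \<eta> upd_F mass_upd])
        with False show ?thesis by (simp add: g_def)
      qed
    qed (rule indicator_int[OF f2])
    finally show ?thesis .
  qed
  have moment_near: "\<bar>(\<integral>\<eta>. g k \<eta> \<partial>\<mu>) * moment (delta_config z) - ?L\<bar> \<le> \<epsilon> k" for k
  proof (rule field_le_epsilon)
    fix e :: real assume e: "0 < e"
    \<comment> \<open>A bound for the occupied sites, from \<open>g_bound\<close> and the
      one-particle dominating function. It may grow with \<open>k\<close>, so time must become large
      before \<open>k\<close> does.\<close>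
    define B where "B = real k * (\<integral>\<eta>. \<bar>f1 \<eta>\<bar> \<partial>\<mu>) + \<bar>?L\<bar>"
    have B: "0 \<le> B" by (simp add: B_def)
    have on: "\<bar>(\<integral>\<eta>. g k \<eta> * D (delta_config y) \<eta> \<partial>\<mu>) - ?L\<bar> \<le> B" for y
    proof -
      have "\<bar>\<integral>\<eta>. g k \<eta> * D (delta_config y) \<eta> \<partial>\<mu>\<bar> \<le> (\<integral>\<eta>. \<bar>g k \<eta> * D (delta_config y) \<eta>\<bar> \<partial>\<mu>)"
        by simp
      also have "\<dots> \<le> (\<integral>\<eta>. real k * \<bar>f1 \<eta>\<bar> \<partial>\<mu>)"
      proof (rule integral_mono)
        show "integrable \<mu> (\<lambda>\<eta>. \<bar>g k \<eta> * D (delta_config y) \<eta>\<bar>)"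
          by (intro integrable_abs g_int D_integrable delta_config_in_F)
        show "integrable \<mu> (\<lambda>\<eta>. real k * \<bar>f1 \<eta>\<bar>)" using f1 by simp
        fix \<eta> assume \<eta>: "\<eta> \<in> space \<mu>"
        have "\<bar>D (delta_config y) \<eta>\<bar> \<le> f1 \<eta>"
          by (rule f1_bound[OF \<eta> delta_config_in_F mass_delta_config])
        then show "\<bar>g k \<eta> * D (delta_config y) \<eta>\<bar> \<le> real k * \<bar>f1 \<eta>\<bar>"
          unfolding abs_mult using g_bound[OF \<eta>, of k] by (intro mult_mono) auto
      qed
      finally show ?thesis by (simp add: B_def)
    qed
    have "((\<lambda>t. \<epsilon> k + B * (\<Sum>y\<in>?A. one_particle_prob Q t z y)) \<longlongrightarrow> \<epsilon> k + B * (\<Sum>y\<in>?A. 0)) at_top"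
      by (intro tendsto_intros spreading)
    then have "eventually (\<lambda>t. \<epsilon> k + B * (\<Sum>y\<in>?A. one_particle_prob Q t z y) < \<epsilon> k + e) at_top"
      by (rule order_tendstoD(2)) (use e in simp)
    then obtain s0 where s0: "\<And>t. s0 \<le> t \<Longrightarrow> \<epsilon> k + B * (\<Sum>y\<in>?A. one_particle_prob Q t z y) < \<epsilon> k + e"
      by (auto simp: eventually_at_top_linorder)
    have \<epsilon>_nonneg: "0 \<le> \<epsilon> k" unfolding \<epsilon>_def by (intro Bochner_Integration.integral_nonneg) simp
    show "\<bar>(\<integral>\<eta>. g k \<eta> \<partial>\<mu>) * moment (delta_config z) - ?L\<bar> \<le> \<epsilon> k + e"
      unfolding moment_def[of "delta_config z"]
    \<comment> \<open>Duality is available at positive times only, whence the lower bound 1.\<close>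
    proof (rule decorrelation[OF erg, where s = "max 1 s0" and C = "real k"])
      show g_S: "g k \<in> borel_measurable (config_space E)"
        using g_meas by (simp add: measurable_cong_sets[OF sets_initial refl])
      show g_S_bound: "\<bar>g k \<eta>\<bar> \<le> real k" if "\<eta> \<in> space (config_space E)" for \<eta>
        using g_bound that by (simp add: space_initial)
      show "integrable \<mu> (D (delta_config z))" by (rule D_integrable[OF delta_config_in_F])
      fix t assume t: "max 1 s0 \<le> t"
      have "(\<integral>\<omega>. g k (\<omega> 0) * D (delta_config z) (\<omega> t) \<partial>law)
          = (\<integral>\<omega>. (\<integral>\<eta>. g k \<eta> * D (\<omega> t) \<eta> \<partial>\<mu>) \<partial>Q (delta_config z))"
        by (rule duality_against_initial[OF _ delta_config_in_F g_S g_S_bound]) (use t in simp_all)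
      also have "\<bar>\<dots> - ?L\<bar> \<le> \<epsilon> k + B * (\<Sum>y\<in>?A. one_particle_prob Q t z y)"
        using t by (intro one_particle_expectation_near A B \<epsilon>_nonneg on off) auto
      also have "\<dots> \<le> \<epsilon> k + e"
        using s0[of t] t by simp
      finally show "\<bar>(\<integral>\<omega>. g k (\<omega> 0) * D (delta_config z) (\<omega> t) \<partial>law) - ?L\<bar> \<le> \<epsilon> k + e" .
    qed simp
  qed
  \<comment> \<open>Now the cutoff is removed; the error is the tail of the dominating function at
    the mass of \<open>\<xi>\<close>.\<close>
  have "(\<lambda>k. \<integral>\<eta>. g k \<eta> \<partial>\<mu>) \<longlonglongrightarrow> moment \<xi>"
  proof (rule LIM_zero_cancel, rule Lim_null_comparison[OF _ \<delta>], intro always_eventually allI)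
    fix k
    have g1: "integrable \<mu> (g k)" using g_int[of "\<lambda>_. 1" k] by simp
    have "(\<integral>\<eta>. g k \<eta> \<partial>\<mu>) - moment \<xi> = (\<integral>\<eta>. g k \<eta> - D \<xi> \<eta> \<partial>\<mu>)"
      unfolding moment_def using g1 D_integrable[OF \<xi>(1)] by simp
    also have "\<bar>\<dots>\<bar> \<le> (\<integral>\<eta>. \<bar>g k \<eta> - D \<xi> \<eta>\<bar> \<partial>\<mu>)"
      by simp
    also have "\<dots> \<le> \<delta> k"
      unfolding \<delta>_def
    proof (rule integral_mono)
      show "integrable \<mu> (\<lambda>\<eta>. \<bar>g k \<eta> - D \<xi> \<eta>\<bar>)"
        using g1 D_integrable[OF \<xi>(1)] by simp
      show "\<bar>g k \<eta> - D \<xi> \<eta>\<bar> \<le> \<bar>f \<eta>\<bar> * indicator {\<eta>. real k < f \<eta>} \<eta>" if "\<eta> \<in> space \<mu>" for \<eta>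
        using f_bound[OF that \<xi>(1) refl] by (auto simp: g_def split: split_indicator)
    qed (rule indicator_int[OF f])
    finally show "norm ((\<integral>\<eta>. g k \<eta> \<partial>\<mu>) - moment \<xi>) \<le> \<delta> k" by simp
  qed
  then have "(\<lambda>k. \<bar>(\<integral>\<eta>. g k \<eta> \<partial>\<mu>) * moment (delta_config z) - ?L\<bar>)
      \<longlonglongrightarrow> \<bar>moment \<xi> * moment (delta_config z) - ?L\<bar>"
    by (intro tendsto_intros)
  from LIMSEQ_le[OF this \<epsilon>] moment_near
  have "\<bar>moment \<xi> * moment (delta_config z) - ?L\<bar> \<le> 0" by blast
  then show ?thesis by simp
qed

text \<open>\<open>moment_fun_upd\<close> builds up the configurations \<open>occ A\<close> with one
  particle at each site of a finite set. As there are infinitely many sites, each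
  \<open>\<xi>\<close> shares its mass with some \<open>occ A\<close>, and therefore its
  moment.\<close>

lemma moment_eq_power:
  assumes erg: "time_ergodic (config_space E) P \<mu>"
    and harmonic: "bounded_harmonic_triviality F Q"
    and spreading: "\<And>x y. ((\<lambda>t. one_particle_prob Q t x y) \<longlongrightarrow> 0) at_top"
    and infinite: "infinite (UNIV :: 'v set)"
    and \<xi>: "\<xi> \<in> F"
  shows "moment \<xi> = moment (delta_config x) ^ mass \<xi>"
proof -
  define occ where "occ A = (\<lambda>y. if y \<in> A then 1 else 0 :: nat)" for A :: "'v set"
  have occ_F: "occ A \<in> F" if "finite A" for A
    using that zero_one_E' by (auto simp: occ_def finite_configs_def)
  have mass_occ: "mass (occ A) = card A" if "finite A" for A
    by (subst mass_superset[OF that]) (auto simp: occ_def that)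
  have delta: "moment (delta_config y) = moment (delta_config x)" for y
    by (rule moment_eq_of_mass_eq[OF harmonic]) (simp_all add: delta_config_in_F mass_delta_config)
  have occ: "moment (occ A) = moment (delta_config x) ^ card A" if "finite A" for A
    using that
  proof induction
    case empty
    have "moment (occ {}) = (\<integral>\<eta>. 1 \<partial>\<mu>)"
      unfolding moment_def
      by (intro Bochner_Integration.integral_cong refl)
        (simp add: factorized_eq_prod[of _ "{}"] occ_def)
    then show ?case by (simp add: initial.prob_space)
  next
    case (insert z A)
    have upd: "occ (insert z A) = (occ A)(z := 1)"
      by (auto simp: occ_def fun_eq_iff)
    have "occ A z = 0" using insert.hyps by (simp add: occ_def)
    then have "moment (occ (insert z A)) = moment (occ A) * moment (delta_config z)"
      unfolding upd by (rule moment_fun_upd[OF erg harmonic spreading occ_F[OF insert.hyps(1)]])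
    then show ?case
      using insert by (simp add: delta[of z])
  qed
  obtain A :: "'v set" where A: "finite A" "card A = mass \<xi>"
    using infinite_arbitrarily_large[OF infinite] by blast
  have "moment \<xi> = moment (occ A)"
    by (rule moment_eq_of_mass_eq[OF harmonic \<xi> occ_F[OF A(1)]]) (simp add: mass_occ A)
  then show ?thesis using occ A by simp
qed

section \<open>From moments to the product measure\<close>

text \<open>Measurability is given for \<open>D\<close> on configuration space; restriction to
  constant configurations brings it down to a single site.\<close>

lemma local_measurable:
  assumes "k \<in> E'"
  shows "d k \<in> borel_measurable (restrict_space borel E)"
proof -
  let ?R = "restrict_space borel E"
  have sp: "space ?R = E" by (simp add: space_restrict_space)
  have const: "(\<lambda>a (_ :: 'v). a) \<in> ?R \<rightarrow>\<^sub>M config_space E"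
    unfolding config_space_def by (rule measurable_PiM_single') (auto simp: sp)
  \<comment> \<open>\<open>undefined\<close> serves as some site; on a constant configuration all
    sites look alike.\<close>
  have "(\<lambda>_. 0)(undefined := k) \<in> F"
    using fun_upd_in_F[OF zero_in_F assms] .
  from measurable_compose[OF const D_measurable[OF this]]
  have *: "(\<lambda>a. D ((\<lambda>_. 0)(undefined := k)) (\<lambda>_. a)) \<in> borel_measurable ?R" .
  show ?thesis
  proof (rule measurable_cong[THEN iffD1, OF _ *])
    fix a assume "a \<in> space ?R"
    then have "(\<lambda>_. a) \<in> space \<mu>"
      by (simp add: sp space_initial space_config_space)
    then show "D ((\<lambda>_. 0)(undefined := k)) (\<lambda>_. a) = d k a"
      by (rule factorized_single)
  qed
qed

text \<open>Placing \<open>k\<close> particles at one site shows that \<open>d k\<close> has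
  integral \<open>c ^ k\<close> under every marginal. Under the product of the marginals the factors
  of \<open>D \<xi>\<close> are independent, so the exponents add up to the mass, as they do for
  \<open>\<mu>\<close>.\<close>

lemma product_measure_of_moments:
  assumes moments: "\<And>\<xi>. \<xi> \<in> F \<Longrightarrow> moment \<xi> = c ^ mass \<xi>"
    and determined: "determined_by F D \<mu>"
  shows "product_measure E \<mu>"
proof -
  let ?R = "restrict_space borel E"
  define \<nu> where "\<nu> x = distr \<mu> ?R (\<lambda>\<eta>. \<eta> x)" for x
  define N where "N = Pi\<^sub>M UNIV \<nu>"
  have comp: "(\<lambda>\<eta>. \<eta> x) \<in> \<mu> \<rightarrow>\<^sub>M ?R" for x
    unfolding measurable_cong_sets[OF sets_initial refl] config_space_def
    by (rule measurable_component_singleton) simp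
  have \<nu>: "prob_space (\<nu> x)" for x
    unfolding \<nu>_def by (rule initial.prob_space_distr[OF comp])
  have sets_\<nu>: "sets (\<nu> x) = sets ?R" for x by (simp add: \<nu>_def)
  interpret N: prob_space N
    unfolding N_def by (rule prob_space_PiM) (rule \<nu>)
  have sets_N: "sets N = sets \<mu>"
    unfolding N_def sets_initial config_space_def by (rule sets_PiM_cong) (simp_all add: sets_\<nu>)
  have space_N: "space N = space \<mu>"
    using sets_N by (rule sets_eq_imp_space_eq)
  have comp_N: "(\<lambda>\<eta>. \<eta> x) \<in> N \<rightarrow>\<^sub>M \<nu> x" for x
    unfolding N_def by (rule measurable_component_singleton) simp
  have marginal: "distr N (\<nu> x) (\<lambda>\<eta>. \<eta> x) = \<nu> x" for x
    unfolding N_def by (rule distr_PiM_component) (simp_all add: \<nu>)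
  \<comment> \<open>The identity map has law \<open>N\<close>, the product of the laws of the
    coordinates: this is the criterion for independence.\<close>
  have indep: "N.indep_vars \<nu> (\<lambda>x \<eta>. \<eta> x) UNIV"
  proof (subst N.indep_vars_iff_distr_eq_PiM')
    show "distr N (Pi\<^sub>M UNIV \<nu>) (\<lambda>\<eta>. \<lambda>x\<in>UNIV. \<eta> x) = Pi\<^sub>M UNIV (\<lambda>x. distr N (\<nu> x) (\<lambda>\<eta>. \<eta> x))"
      unfolding marginal by (simp add: N_def[symmetric] restrict_def)
  qed (simp_all add: comp_N)
  have dk: "d k \<in> borel_measurable (\<nu> x)" if "k \<in> E'" for k x
    using local_measurable[OF that] by (simp add: measurable_cong_sets[OF sets_\<nu> refl])
  have single: "integrable N (\<lambda>\<eta>. d k (\<eta> x))" "(\<integral>\<eta>. d k (\<eta> x) \<partial>N) = c ^ k" if k: "k \<in> E'" for k x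
  proof -
    let ?\<xi> = "(\<lambda>_. 0)(x := k)"
    have F: "?\<xi> \<in> F" by (rule fun_upd_in_F[OF zero_in_F k])
    have "integrable \<mu> (\<lambda>\<eta>. d k (\<eta> x))"
      using D_integrable[OF F]
      by (rule Bochner_Integration.integrable_cong[OF refl, THEN iffD1, rotated]) (rule factorized_single)
    then have "integrable (\<nu> x) (d k)"
      unfolding \<nu>_def by (simp add: integrable_distr_eq[OF comp local_measurable[OF k]])
    then show "integrable N (\<lambda>\<eta>. d k (\<eta> x))"
      using integrable_distr_eq[OF comp_N dk[OF k], of x] by (simp add: marginal)
    have "mass ?\<xi> = k"
      by (subst mass_superset[of "{x}"]) auto
    then have "c ^ k = moment ?\<xi>" using moments[OF F] by simp
    also have "\<dots> = (\<integral>\<eta>. d k (\<eta> x) \<partial>\<mu>)"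
      unfolding moment_def by (intro Bochner_Integration.integral_cong refl factorized_single)
    also have "\<dots> = (\<integral>a. d k a \<partial>\<nu> x)"
      unfolding \<nu>_def by (rule integral_distr[OF comp local_measurable[OF k], symmetric])
    also have "\<dots> = (\<integral>\<eta>. d k (\<eta> x) \<partial>N)"
      using integral_distr[OF comp_N dk[OF k], of x] by (simp add: marginal)
    finally show "(\<integral>\<eta>. d k (\<eta> x) \<partial>N) = c ^ k" by simp
  qed
  have "integrable N (D \<xi>) \<and> (\<integral>\<eta>. D \<xi> \<eta> \<partial>N) = (\<integral>\<eta>. D \<xi> \<eta> \<partial>\<mu>)" if \<xi>: "\<xi> \<in> F" for \<xi>
  proof -
    let ?A = "{x. \<xi> x \<noteq> 0}"
    have A: "finite ?A" by (rule finite_support[OF \<xi>])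
    have in_E': "\<xi> x \<in> E'" for x using \<xi> by (simp add: finite_configs_def)
    have D_eq: "D \<xi> \<eta> = (\<Prod>x\<in>?A. d (\<xi> x) (\<eta> x))" if "\<eta> \<in> space N" for \<eta>
      using that A by (intro factorized_eq_prod) (simp_all add: space_N)
    have ind: "N.indep_vars (\<lambda>_. borel) (\<lambda>x \<eta>. d (\<xi> x) (\<eta> x)) ?A"
      by (rule N.indep_vars_compose2[OF N.indep_vars_subset[OF indep]]) (simp_all add: dk in_E')
    have "integrable N (\<lambda>\<eta>. \<Prod>x\<in>?A. d (\<xi> x) (\<eta> x))"
      by (rule N.indep_vars_integrable[OF A ind]) (rule single(1)[OF in_E'])
    then have int: "integrable N (D \<xi>)"
      by (rule Bochner_Integration.integrable_cong[OF refl, THEN iffD1, rotated]) (simp add: D_eq)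
    have "(\<integral>\<eta>. D \<xi> \<eta> \<partial>N) = (\<integral>\<eta>. (\<Prod>x\<in>?A. d (\<xi> x) (\<eta> x)) \<partial>N)"
      by (intro Bochner_Integration.integral_cong refl D_eq)
    also have "\<dots> = (\<Prod>x\<in>?A. \<integral>\<eta>. d (\<xi> x) (\<eta> x) \<partial>N)"
      by (rule N.indep_vars_lebesgue_integral[OF A ind]) (rule single(1)[OF in_E'])
    also have "\<dots> = (\<Prod>x\<in>?A. c ^ \<xi> x)"
      by (intro prod.cong refl single(2) in_E')
    also have "\<dots> = c ^ mass \<xi>"
      by (simp add: power_sum mass_def)
    also have "\<dots> = (\<integral>\<eta>. D \<xi> \<eta> \<partial>\<mu>)"
      using moments[OF \<xi>] by (simp add: moment_def)
    finally show ?thesis using int by simp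
  qed
  then have "N = \<mu>"
    using determined sets_N N.prob_space_axioms unfolding determined_by_def by blast
  then have "\<mu> = Pi\<^sub>M UNIV \<nu>"
    by (simp add: N_def)
  with \<nu> sets_\<nu> show ?thesis
    unfolding product_measure_def by (intro exI[of _ \<nu>]) simp
qed

end

text \<open>Equal moments identify two measures when the duality functions determine the measure;
  \<open>determined_by\<close> expresses this for the given \<open>\<mu>\<close>, as premise of the
  final clause. The bound \<open>N \<ge> 1\<close> makes \<open>delta_config x\<close> an admissible
  configuration.\<close>

theorem theorem3p4:
  fixes E :: "real set" and E' :: "nat set"
    and d :: "nat \<Rightarrow> real \<Rightarrow> real"
    and P :: "(int ^ 'd \<Rightarrow> real) \<Rightarrow> (real \<Rightarrow> int ^ 'd \<Rightarrow> real) measure"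
    and Q :: "(int ^ 'd \<Rightarrow> nat) \<Rightarrow> (real \<Rightarrow> int ^ 'd \<Rightarrow> nat) measure"
    and \<mu> :: "(int ^ 'd \<Rightarrow> real) measure"
  assumes E: "E = \<nat> \<or> (\<exists>N::nat. E = real ` {0..N}) \<or> E = {0..}"
    and E': "E' = UNIV \<or> (\<exists>N\<ge>1. E' = {0..N})"
    and process: "markov_process (config_space E) P"
    and dual_process: "markov_process (count_space (finite_configs E')) Q"
    and d_0: "\<forall>a\<in>E. d 0 a = 1"
    and duality: "dual_processes (config_space E) P (finite_configs E') Q (factorized d)"
    and conservation: "conserves_particles (finite_configs E') Q"
    and harmonic: "bounded_harmonic_triviality (finite_configs E') Q"
    and spreading: "\<forall>x y. ((\<lambda>t. one_particle_prob Q t x y) \<longlongrightarrow> 0) at_top"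
    and prob_\<mu>: "prob_space \<mu>" "sets \<mu> = sets (config_space E)"
    and domination: "uniformly_dominated (finite_configs E') (factorized d) \<mu>"
    and stationary: "stationary (config_space E) P \<mu>"
    and ergodic: "time_ergodic (config_space E) P \<mu>"
  shows "(\<forall>\<xi>\<in>finite_configs E'. \<forall>x.
            (\<integral>\<eta>. factorized d \<xi> \<eta> \<partial>\<mu>) = (\<integral>\<eta>. factorized d (delta_config x) \<eta> \<partial>\<mu>) ^ mass \<xi>) \<and>
         (determined_by (finite_configs E') (factorized d) \<mu> \<longrightarrow> product_measure E \<mu>)"
proof -
  have zero_one: "0 \<in> E'" "1 \<in> E'"
    using E' by auto
  interpret dual_process E P \<mu> E' d Q
    by unfold_locales
      (fact process stationary dual_process zero_one d_0 duality conservation domination)+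
  have infinite: "infinite (UNIV :: (int ^ 'd) set)"
  proof
    assume "finite (UNIV :: (int ^ 'd) set)"
    \<comment> \<open>The constant vectors form a copy of the integers in every dimension.\<close>
    then have "finite (range (vec :: int \<Rightarrow> int ^ 'd))"
      by (rule finite_subset[OF subset_UNIV])
    moreover have "inj (vec :: int \<Rightarrow> int ^ 'd)"
      by (auto intro!: injI simp: vec_eq_iff)
    ultimately show False
      using finite_imageD infinite_UNIV_int by blast
  qed
  have moments: "moment \<xi> = moment (delta_config x) ^ mass \<xi>" if "\<xi> \<in> finite_configs E'" for \<xi> x
    using moment_eq_power[OF ergodic harmonic _ infinite that] spreading by blast
  show ?thesis
    using moments product_measure_of_moments[OF moments] by (auto simp: moment_def)
qed

end
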